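(* Let $K$ be a field of characteristic zero, $S=K[x_1,x_2,x_3]$, and let $d_1,d_2,d_3$ be positive integers. Then for a generic sequence $f_1,f_2,f_3$ of homogeneous polynomials of degrees $d_1,d_2,d_3$, the initial ideal $\operatorname{in}(I)$ of $I=(f_1,f_2,f_3)$ with respect to the reverse lexicographic order is an almost reverse lexicographic ideal. (That is, Moreno's conjecture holds for $n=3$.)
   Context: The reverse lexicographic order on $S$ is taken with $x_1>x_2>x_3$: for monomials of the same degree, $x^a>x^b$ iff the last nonzero entry of $a-b$ is negative. A property holds for a generic sequence of homogeneous polynomials of degrees $d_1,d_2,d_3$ if there is a nonempty Zariski open subset $U\subseteq S_{d_1}\times S_{d_2}\times S_{d_3}$ such that the property holds for every $(f_1,f_2,f_3)\in U$. A monomial ideal $J$ is almost reverse lexicographic if whenever $u$ is a minimal monomial generator of $J$ and $v$ is a monomial with $\deg v=\deg u$ and $v>u$ in the reverse lexicographic order, then $v\in J$. *)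

theory Defs
  imports Main "HOL-Library.Poly_Mapping" "HOL-Library.Product_Plus"
begin

type_synonym mono3 = "nat \<times> nat \<times> nat"
type_synonym 'a poly3 = "mono3 \<Rightarrow>\<^sub>0 'a"

definition mdeg :: "mono3 \<Rightarrow> nat" where
  "mdeg m = (case m of (a1, a2, a3) \<Rightarrow> a1 + a2 + a3)"

text \<open>Reverse lexicographic comparison x^a > x^b (x1 > x2 > x3):
  the last nonzero entry of a - b is negative.\<close>
definition revlex_gt :: "mono3 \<Rightarrow> mono3 \<Rightarrow> bool" where
  "revlex_gt a b = (case a of (a1, a2, a3) \<Rightarrow> case b of (b1, b2, b3) \<Rightarrow>
      a3 < b3 \<or> (a3 = b3 \<and> a2 < b2) \<or> (a3 = b3 \<and> a2 = b2 \<and> a1 < b1))"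

definition mono_gt :: "mono3 \<Rightarrow> mono3 \<Rightarrow> bool" where
  "mono_gt a b = (mdeg b < mdeg a \<or> (mdeg a = mdeg b \<and> revlex_gt a b))"

definition monom :: "mono3 \<Rightarrow> 'a::zero_neq_one poly3" where
  "monom m = Poly_Mapping.single m 1"

definition mdvd :: "mono3 \<Rightarrow> mono3 \<Rightarrow> bool" where
  "mdvd a b = (case a of (a1, a2, a3) \<Rightarrow> case b of (b1, b2, b3) \<Rightarrow>
      a1 \<le> b1 \<and> a2 \<le> b2 \<and> a3 \<le> b3)"

definition homogeneous :: "nat \<Rightarrow> 'a::zero poly3 \<Rightarrow> bool" where
  "homogeneous d f = (\<forall>m\<in>Poly_Mapping.keys f. mdeg m = d)"

definition lead_mono :: "'a::zero poly3 \<Rightarrow> mono3" where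
  "lead_mono f = (THE m. m \<in> Poly_Mapping.keys f \<and> (\<forall>m'\<in>Poly_Mapping.keys f. m' \<noteq> m \<longrightarrow> mono_gt m m'))"

definition ideal_gen :: "'a::comm_ring_1 poly3 set \<Rightarrow> 'a poly3 set" where
  "ideal_gen G = {g. \<exists>A H. finite A \<and> A \<subseteq> G \<and> g = (\<Sum>p\<in>A. H p * p)}"

definition initial_ideal :: "'a::comm_ring_1 poly3 set \<Rightarrow> 'a poly3 set" where
  "initial_ideal I = ideal_gen {monom (lead_mono g) | g. g \<in> I \<and> g \<noteq> 0}"

definition min_mono_gen :: "'a::comm_ring_1 poly3 set \<Rightarrow> mono3 \<Rightarrow> bool" where
  "min_mono_gen J u = (monom u \<in> J \<and> \<not> (\<exists>w. monom w \<in> J \<and> w \<noteq> u \<and> mdvd w u))"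

definition almost_revlex :: "'a::comm_ring_1 poly3 set \<Rightarrow> bool" where
  "almost_revlex J = (\<forall>u v. min_mono_gen J u \<and> mdeg v = mdeg u \<and> revlex_gt v u
      \<longrightarrow> monom v \<in> J)"

text \<open>Affine space S_{d1} x S_{d2} x S_{d3} and its Zariski topology.
  Coordinates are indexed by (i, m): the coefficient of monomial m in f_(i+1).\<close>

definition hspace :: "nat \<Rightarrow> nat \<Rightarrow> nat \<Rightarrow> ('a::zero poly3 \<times> 'a poly3 \<times> 'a poly3) set" where
  "hspace d1 d2 d3 = {(f1, f2, f3). homogeneous d1 f1 \<and> homogeneous d2 f2 \<and> homogeneous d3 f3}"

definition coord :: "('a::zero poly3 \<times> 'a poly3 \<times> 'a poly3) \<Rightarrow> nat \<times> mono3 \<Rightarrow> 'a" where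
  "coord f v = (case f of (f1, f2, f3) \<Rightarrow> case v of (i, m) \<Rightarrow>
      (if i = 0 then Poly_Mapping.lookup f1 m else if i = 1 then Poly_Mapping.lookup f2 m
       else if i = 2 then Poly_Mapping.lookup f3 m else 0))"

definition peval :: "(((nat \<times> mono3) \<Rightarrow>\<^sub>0 nat) \<Rightarrow>\<^sub>0 'a::comm_ring_1) \<Rightarrow> (nat \<times> mono3 \<Rightarrow> 'a) \<Rightarrow> 'a" where
  "peval P x = (\<Sum>\<mu>\<in>Poly_Mapping.keys P. Poly_Mapping.lookup P \<mu> * (\<Prod>v\<in>Poly_Mapping.keys \<mu>. x v ^ Poly_Mapping.lookup \<mu> v))"

definition zariski_open :: "nat \<Rightarrow> nat \<Rightarrow> nat \<Rightarrow> ('a::comm_ring_1 poly3 \<times> 'a poly3 \<times> 'a poly3) set \<Rightarrow> bool" where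
  "zariski_open d1 d2 d3 U = (\<exists>F. U = {f \<in> hspace d1 d2 d3. \<exists>P\<in>F. peval P (coord f) \<noteq> 0})"

definition generic :: "nat \<Rightarrow> nat \<Rightarrow> nat \<Rightarrow> ('a::comm_ring_1 poly3 \<times> 'a poly3 \<times> 'a poly3 \<Rightarrow> bool) \<Rightarrow> bool" where
  "generic d1 d2 d3 Q = (\<exists>U. zariski_open d1 d2 d3 U \<and> U \<noteq> {} \<and> (\<forall>f\<in>U. Q f))"

definition gen_ideal3 :: "'a::comm_ring_1 poly3 \<Rightarrow> 'a poly3 \<Rightarrow> 'a poly3 \<Rightarrow> 'a poly3 set" where
  "gen_ideal3 f1 f2 f3 = {h1 * f1 + h2 * f2 + h3 * f3 | h1 h2 h3. True}"

end

theory Submission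
  imports Defs "HOL-Computational_Algebra.Polynomial"
begin

text \<open>
  Put \<open>e = d1 + d2 + d3 - 3\<close>. By the strong Lefschetz property, for generic \<open>f\<close> the multiplication by
  \<open>x3^(e - 2i)\<close> is a bijection from the degree \<open>i\<close> part of \<open>S/I\<close> to its degree \<open>e - i\<close> part. Injectivity
  shows that a minimal generator \<open>x1^a x2^b x3^c\<close> of \<open>in(I)\<close> with \<open>c > 0\<close> has \<open>2(a + b) + c > e\<close>, and
  surjectivity puts every monomial satisfying this inequality into \<open>in(I)\<close>; passing to a larger
  monomial of the same degree preserves it. For \<open>c = 0\<close> it suffices that the
  restriction of \<open>I\<close> to \<open>x3 = 0\<close> has an initial segment of monomials as leading monomials in every
  degree.

  Bijectivity is an open condition because it amounts to the exactness of a complex of finite-dimensional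
  spaces built from \<open>x3^k\<close> and the Koszul relations; it holds for \<open>x1^d1, x2^d2, (x3 - x1 - x2)^d3\<close>,
  that is, for the monomial complete intersection and the linear form \<open>y1 + y2 + y3\<close>, by the
  commutation relations of \<open>sl2\<close>. The condition on the restriction is open near
  a point where the dimension in question is maximal, and a general shift \<open>x2 \<mapsto> x2 + t x1\<close> of such a
  point satisfies it by a Wronskian argument in characteristic zero.
\<close>

section \<open>Linear independence of finite families\<close>

text \<open>The number \<open>e\<close> is the socle degree of the quotient by a complete
  intersection of degrees d1, d2, d3; degrees i and e - i are dual there. Surjectivity of a
  multiplication is visibly an open condition, but injectivity modulo \<open>I\<close> is not: the
  ideal itself moves with \<open>f\<close>, and its dimension in a given degree is not known to be
  constant. The Koszul relations repair this. They move polynomially with \<open>f\<close>, so a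
  basis adapted to them at one point stays independent nearby and, by counting, keeps spanning; no
  Hilbert function has to be computed. The Lefschetz maps say nothing about the order among
  monomials of equal x3-exponent, hence the separate condition modulo x3. All openness claims are
  phrased as linear independence of finite families, indexed so that the index set stays fixed while
  the vectors vary with \<open>f\<close>. Finitely many conditions suffice, since generically every
  form of degree e + 1 lies in \<open>I\<close>.\<close>

definition indep :: "'k set \<Rightarrow> ('k \<Rightarrow> 'b \<Rightarrow> 'a::field) \<Rightarrow> bool" where
  "indep K v \<longleftrightarrow> (\<forall>\<alpha>. (\<forall>b. (\<Sum>k\<in>K. \<alpha> k * v k b) = 0) \<longrightarrow> (\<forall>k\<in>K. \<alpha> k = 0))"

lemma indepI:
  "(\<And>\<alpha> k. (\<And>b. (\<Sum>k\<in>K. \<alpha> k * v k b) = 0) \<Longrightarrow> k \<in> K \<Longrightarrow> \<alpha> k = 0) \<Longrightarrow> indep K v"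
  unfolding indep_def by blast

lemma indepD:
  "indep K v \<Longrightarrow> (\<And>b. (\<Sum>k\<in>K. \<alpha> k * v k b) = 0) \<Longrightarrow> k \<in> K \<Longrightarrow> \<alpha> k = 0"
  unfolding indep_def by blast

lemma indep_empty [simp]: "indep {} v"
  by (simp add: indep_def)

lemma indep_cong:
  assumes "\<And>k b. k \<in> K \<Longrightarrow> v k b = w k b"
  shows "indep K v \<longleftrightarrow> indep K w"
proof -
  have "(\<Sum>k\<in>K. \<alpha> k * v k b) = (\<Sum>k\<in>K. \<alpha> k * w k b)" for \<alpha> b
    by (intro sum.cong) (auto simp: assms)
  then show ?thesis unfolding indep_def by simp
qed

lemma indep_image:
  assumes "inj_on h K"
  shows "indep (h ` K) v \<longleftrightarrow> indep K (v \<circ> h)"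
proof
  assume i: "indep (h ` K) v"
  show "indep K (v \<circ> h)"
  proof (rule indepI)
    fix \<alpha> k
    assume s: "\<And>b. (\<Sum>k\<in>K. \<alpha> k * (v \<circ> h) k b) = 0" and k: "k \<in> K"
    have "(\<Sum>k\<in>h ` K. (\<alpha> \<circ> inv_into K h) k * v k b) = 0" for b
      using s[of b] assms by (simp add: sum.reindex)
    from indepD[OF i this, of "h k"] k assms show "\<alpha> k = 0" by simp
  qed
next
  assume i: "indep K (v \<circ> h)"
  show "indep (h ` K) v"
  proof (rule indepI)
    fix \<alpha> k
    assume s: "\<And>b. (\<Sum>k\<in>h ` K. \<alpha> k * v k b) = 0" and k: "k \<in> h ` K"
    have "(\<Sum>k\<in>K. (\<alpha> \<circ> h) k * (v \<circ> h) k b) = 0" for b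
      using s[of b] assms by (simp add: sum.reindex)
    from indepD[OF i this] k show "\<alpha> k = 0" by auto
  qed
qed

text \<open>Gaussian elimination with pivot entry \<open>v k0 b0\<close>, done without division, so
  that entries polynomial in a parameter remain so.\<close>

lemma indep_eliminate:
  fixes v :: "'k \<Rightarrow> 'b \<Rightarrow> 'a::field"
  assumes K: "finite K" "k0 \<notin> K" and nz: "v k0 b0 \<noteq> 0"
  shows "indep (insert k0 K) v \<longleftrightarrow> indep K (\<lambda>k b. v k0 b0 * v k b - v k b0 * v k0 b)"
proof
  assume i: "indep (insert k0 K) v"
  show "indep K (\<lambda>k b. v k0 b0 * v k b - v k b0 * v k0 b)"
  proof (rule indepI)
    fix \<alpha> k
    assume s: "\<And>b. (\<Sum>k\<in>K. \<alpha> k * (v k0 b0 * v k b - v k b0 * v k0 b)) = 0" and k: "k \<in> K"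
    define \<beta> where "\<beta> k = (if k = k0 then - (\<Sum>k\<in>K. \<alpha> k * v k b0) else \<alpha> k * v k0 b0)" for k
    have "(\<Sum>k\<in>insert k0 K. \<beta> k * v k b) = 0" for b
    proof -
      have "(\<Sum>k\<in>K. \<beta> k * v k b) = (\<Sum>k\<in>K. \<alpha> k * v k0 b0 * v k b)"
        by (intro sum.cong) (use K in \<open>auto simp: \<beta>_def\<close>)
      moreover have "\<beta> k0 * v k0 b = - (\<Sum>k\<in>K. \<alpha> k * v k b0 * v k0 b)"
        by (simp add: \<beta>_def sum_distrib_right)
      ultimately show ?thesis
        using s[of b] K by (simp add: right_diff_distrib sum_subtractf mult.assoc)
    qed
    from indepD[OF i this, of k] k K nz show "\<alpha> k = 0" by (auto simp: \<beta>_def split: if_splits)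
  qed
next
  assume i: "indep K (\<lambda>k b. v k0 b0 * v k b - v k b0 * v k0 b)"
  show "indep (insert k0 K) v"
  proof (rule indepI)
    fix \<alpha> k
    assume s: "\<And>b. (\<Sum>k\<in>insert k0 K. \<alpha> k * v k b) = 0" and k: "k \<in> insert k0 K"
    have t: "(\<Sum>k\<in>K. \<alpha> k * v k b) = - \<alpha> k0 * v k0 b" for b
      using s[of b] K by (simp add: eq_neg_iff_add_eq_0 add.commute)
    have "(\<Sum>k\<in>K. \<alpha> k * (v k0 b0 * v k b - v k b0 * v k0 b)) = 0" for b
    proof -
      have "(\<Sum>k\<in>K. \<alpha> k * (v k0 b0 * v k b - v k b0 * v k0 b))
          = v k0 b0 * (\<Sum>k\<in>K. \<alpha> k * v k b) - (\<Sum>k\<in>K. \<alpha> k * v k b0) * v k0 b"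
        by (simp add: right_diff_distrib sum_subtractf sum_distrib_left sum_distrib_right mult_ac)
      also have "\<dots> = 0" by (simp add: t)
      finally show ?thesis .
    qed
    then have z: "\<forall>k\<in>K. \<alpha> k = 0" using indepD[OF i] by blast
    then have "(\<Sum>k\<in>K. \<alpha> k * v k b0) = 0" by simp
    with t[of b0] nz have "\<alpha> k0 = 0" by simp
    with z k show "\<alpha> k = 0" by auto
  qed
qed

lemma indep_insert_nonzero:
  assumes "finite K" "indep (insert k0 K) v"
  obtains b where "v k0 b \<noteq> 0"
proof -
  have "\<exists>b. v k0 b \<noteq> 0"
  proof (rule ccontr)
    assume "\<not> ?thesis"
    then have "(\<Sum>k\<in>insert k0 K. (if k = k0 then 1 else 0) * v k b) = 0" for b
      by (intro sum.neutral) auto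
    from indepD[OF assms(2) this, of k0] show False by simp
  qed
  with that show ?thesis by blast
qed

text \<open>Elimination at a pivot \<open>b0\<close> makes all remaining vectors vanish at
  \<open>b0\<close>, so one index and one coordinate are removed together.\<close>

lemma indep_card_le:
  fixes v :: "'k \<Rightarrow> 'b \<Rightarrow> 'a::field"
  assumes "finite K" "finite B" "indep K v" "\<And>k b. k \<in> K \<Longrightarrow> b \<notin> B \<Longrightarrow> v k b = 0"
  shows "card K \<le> card B"
  using assms
proof (induction K arbitrary: v B rule: finite_induct)
  case empty
  then show ?case by simp
next
  case (insert k0 K)
  obtain b0 where b0: "v k0 b0 \<noteq> 0"
    by (rule indep_insert_nonzero[OF insert.hyps(1) insert.prems(2)])
  then have b0B: "b0 \<in> B" using insert.prems(3)[of k0 b0] by auto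
  have "card K \<le> card (B - {b0})"
  proof (rule insert.IH)
    show "indep K (\<lambda>k b. v k0 b0 * v k b - v k b0 * v k0 b)"
      using indep_eliminate[where v=v, OF insert.hyps b0] insert.prems(2) by simp
  qed (use insert.prems in auto)
  moreover have "card B > 0" using b0B insert.prems card_gt_0_iff by blast
  ultimately show ?case using b0B insert.hyps insert.prems by simp
qed

lemma indep_not_insert:
  fixes v :: "'k \<Rightarrow> 'b \<Rightarrow> 'a::field"
  assumes "finite K" "k0 \<notin> K" "indep K v" "\<not> indep (insert k0 K) v"
  obtains \<alpha> where "\<And>b. v k0 b = (\<Sum>k\<in>K. \<alpha> k * v k b)"
proof -
  from assms(4) obtain \<alpha> k where s: "\<And>b. (\<Sum>k\<in>insert k0 K. \<alpha> k * v k b) = 0"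
    and k: "k \<in> insert k0 K" "\<alpha> k \<noteq> 0" unfolding indep_def by blast
  have nz: "\<alpha> k0 \<noteq> 0"
  proof
    assume z: "\<alpha> k0 = 0"
    then have "(\<Sum>k\<in>K. \<alpha> k * v k b) = 0" for b using s[of b] assms by simp
    from indepD[OF assms(3) this] k z show False by auto
  qed
  have "v k0 b = (\<Sum>k\<in>K. (- \<alpha> k / \<alpha> k0) * v k b)" for b
  proof -
    have "\<alpha> k0 * v k0 b = - (\<Sum>k\<in>K. \<alpha> k * v k b)"
      using s[of b] assms by (simp add: eq_neg_iff_add_eq_0)
    then have "v k0 b = - (\<Sum>k\<in>K. \<alpha> k * v k b) / \<alpha> k0"
      using nz by (simp add: field_simps)
    then show ?thesis
      by (simp add: sum_divide_distrib flip: sum_negf)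
  qed
  then show ?thesis by (rule that)
qed

text \<open>Otherwise \<open>w\<close> could be adjoined to the family under the fresh index
  \<open>None\<close>, giving more independent vectors than coordinates.\<close>

lemma indep_span:
  fixes v :: "'k \<Rightarrow> 'b \<Rightarrow> 'a::field"
  assumes K: "finite K" and B: "finite B" and i: "indep K v" and c: "card B \<le> card K"
    and sv: "\<And>k b. k \<in> K \<Longrightarrow> b \<notin> B \<Longrightarrow> v k b = 0" and sw: "\<And>b. b \<notin> B \<Longrightarrow> w b = 0"
  obtains \<alpha> where "\<And>b. w b = (\<Sum>k\<in>K. \<alpha> k * v k b)"
proof -
  define v' where "v' k = (case k of None \<Rightarrow> w | Some k \<Rightarrow> v k)" for k
  have i': "indep (Some ` K) v'"
    using i by (subst indep_image) (auto simp: v'_def o_def)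
  have "\<not> indep (insert None (Some ` K)) v'"
  proof
    assume "indep (insert None (Some ` K)) v'"
    then have "card (insert None (Some ` K)) \<le> card B"
      by (rule indep_card_le[rotated 2]) (use K B sv sw in \<open>auto simp: v'_def\<close>)
    moreover have "card (insert None (Some ` K)) = Suc (card K)"
      using K by (subst card_insert_disjoint) (auto simp: card_image)
    ultimately show False using c by simp
  qed
  then obtain \<alpha> where "\<And>b. v' None b = (\<Sum>k\<in>Some ` K. \<alpha> k * v' k b)"
    using indep_not_insert[OF _ _ i'] K by blast
  then have "w b = (\<Sum>k\<in>K. \<alpha> (Some k) * v k b)" for b
    by (simp add: v'_def sum.reindex)
  then show ?thesis by (rule that)
qed

text \<open>The coefficients expressing the unit vectors through \<open>v\<close> form a left
  inverse of the matrix \<open>v\<close>, so its rows are independent, in a space with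
  \<open>card K\<close> coordinates.\<close>

lemma spanning_card_ge:
  fixes v :: "'k \<Rightarrow> 'b \<Rightarrow> 'a::field"
  assumes K: "finite K" and B: "finite B"
    and s: "\<And>b. b \<in> B \<Longrightarrow> \<exists>\<alpha>. \<forall>b'. (if b' = b then 1 else 0) = (\<Sum>k\<in>K. \<alpha> k * v k b')"
  shows "card B \<le> card K"
proof -
  obtain A where A: "\<And>b b'. b \<in> B \<Longrightarrow> (if b' = b then 1 else 0) = (\<Sum>k\<in>K. A b k * v k b')"
    using s by metis
  have "indep B (\<lambda>b k. if k \<in> K then A b k else 0)"
  proof (rule indepI)
    fix \<beta> b
    assume z: "\<And>k. (\<Sum>b\<in>B. \<beta> b * (if k \<in> K then A b k else 0)) = 0" and b: "b \<in> B"
    have z': "(\<Sum>b\<in>B. \<beta> b * A b k) = 0" if "k \<in> K" for k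
      using z[of k] that by simp
    have "\<beta> b = (\<Sum>b'\<in>B. if b' = b then \<beta> b' else 0)"
      using B b by simp
    also have "\<dots> = (\<Sum>b'\<in>B. \<beta> b' * (if b = b' then 1 else 0))"
      by (intro sum.cong) auto
    also have "\<dots> = (\<Sum>b'\<in>B. \<beta> b' * (\<Sum>k\<in>K. A b' k * v k b))"
      by (intro sum.cong refl) (subst A, auto)
    also have "\<dots> = (\<Sum>k\<in>K. (\<Sum>b'\<in>B. \<beta> b' * A b' k) * v k b)"
      unfolding sum_distrib_left sum_distrib_right by (subst sum.swap) (simp add: mult.assoc)
    also have "\<dots> = 0" using z' by simp
    finally show "\<beta> b = 0" .
  qed
  then show ?thesis by (rule indep_card_le[OF B K]) auto
qed

text \<open>\<open>P\<close> may be infinite: the number of coordinates bounds the size of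
  independent subfamilies, so one of greatest size exists and no further member can be adjoined to
  it.\<close>

lemma maximal_indep:
  fixes v :: "'k \<Rightarrow> 'b \<Rightarrow> 'a::field"
  assumes B: "finite B" and sv: "\<And>k b. k \<in> P \<Longrightarrow> b \<notin> B \<Longrightarrow> v k b = 0"
  obtains C where "finite C" "C \<subseteq> P" "indep C v"
    "\<And>p. p \<in> P \<Longrightarrow> \<exists>\<alpha>. \<forall>b. v p b = (\<Sum>k\<in>C. \<alpha> k * v k b)"
proof -
  let ?Q = "\<lambda>n. \<exists>C. finite C \<and> C \<subseteq> P \<and> indep C v \<and> card C = n"
  have q0: "?Q 0" by (intro exI[of _ "{}"]) simp
  have bd: "n \<le> card B" if "?Q n" for n
  proof -
    from that obtain C where C: "finite C" "C \<subseteq> P" "indep C v" "card C = n" by blast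
    from indep_card_le[OF C(1) B C(3)] sv C(2,4) show ?thesis by blast
  qed
  define n where "n = (GREATEST n. ?Q n)"
  have n1: "?Q n" unfolding n_def by (rule GreatestI_nat[of ?Q, OF q0 bd])
  have n2: "m \<le> n" if "?Q m" for m unfolding n_def by (rule Greatest_le_nat[of ?Q, OF that bd])
  from n1 obtain C where C: "finite C" "C \<subseteq> P" "indep C v" "card C = n" by blast
  have "\<exists>\<alpha>. \<forall>b. v p b = (\<Sum>k\<in>C. \<alpha> k * v k b)" if p: "p \<in> P" for p
  proof (cases "p \<in> C")
    case True
    have "v p b = (\<Sum>k\<in>C. if k = p then v k b else 0)" for b
      using True C(1) by simp
    also have "(\<Sum>k\<in>C. if k = p then v k b else 0) = (\<Sum>k\<in>C. (if k = p then 1 else 0) * v k b)" for b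
      by (intro sum.cong) auto
    finally have "v p b = (\<Sum>k\<in>C. (if k = p then 1 else 0) * v k b)" for b .
    then show ?thesis by (intro exI[of _ "\<lambda>k. if k = p then 1 else 0"]) simp
  next
    case False
    have ni: "\<not> indep (insert p C) v"
    proof
      assume "indep (insert p C) v"
      then have "Suc n \<le> n" using C p False
        by (intro n2 exI[of _ "insert p C"]) auto
      then show False by simp
    qed
    show ?thesis by (rule indep_not_insert[OF C(1) False C(3) ni]) blast
  qed
  with C(1-3) show ?thesis by (rule that)
qed

section \<open>Polynomials as finitely supported functions\<close>

abbreviation "lookup \<equiv> Poly_Mapping.lookup"
abbreviation "keys \<equiv> Poly_Mapping.keys"
abbreviation "single \<equiv> Poly_Mapping.single"

lemma poly_mapping_sum_single:
  fixes f :: "'m \<Rightarrow>\<^sub>0 'a::comm_monoid_add"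
  shows "f = (\<Sum>m\<in>keys f. single m (lookup f m))"
proof (rule poly_mapping_eqI)
  fix k
  show "lookup f k = lookup (\<Sum>m\<in>keys f. single m (lookup f m)) k"
    by (simp add: lookup_sum lookup_single when_def in_keys_iff)
qed

lemma poly_mapping_induct [case_names zero single add]:
  fixes f :: "'m \<Rightarrow>\<^sub>0 'a::comm_monoid_add"
  assumes "P 0" "\<And>m c. P (single m c)" "\<And>f g. P f \<Longrightarrow> P g \<Longrightarrow> P (f + g)"
  shows "P f"
proof -
  have "P (\<Sum>m\<in>A. single m (lookup f m))" for A
    by (induction A rule: infinite_finite_induct) (auto intro: assms)
  from this[of "keys f"] show ?thesis by (simp flip: poly_mapping_sum_single)
qed

lemma keys_diff_subset:
  fixes f g :: "'m \<Rightarrow>\<^sub>0 'a::ab_group_add"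
  shows "keys (f - g) \<subseteq> keys f \<union> keys g"
  by (auto simp: in_keys_iff lookup_minus)

lemma keys_uminus [simp]:
  fixes f :: "'m \<Rightarrow>\<^sub>0 'a::ab_group_add"
  shows "keys (- f) = keys f"
  by (auto simp: in_keys_iff)

lemma mdvd_add_iff: "mdvd n m \<and> k = m - n \<longleftrightarrow> n + k = m"
  by (cases n; cases m; cases k) (auto simp: mdvd_def)

lemma lookup_single_times:
  fixes f :: "'a::comm_ring_1 poly3"
  shows "lookup (single n c * f) m = (if mdvd n m then c * lookup f (m - n) else 0)"
proof (induction f rule: poly_mapping_induct)
  case (single k d)
  show ?case
    using mdvd_add_iff[of n m k] by (auto simp: mult_single lookup_single when_def)
qed (auto simp: lookup_add distrib_left)

lemma lookup_single_times_add [simp]: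
  fixes f :: "'a::comm_ring_1 poly3"
  shows "lookup (single n c * f) (n + m) = c * lookup f m"
  using mdvd_add_iff[of n "n + m" m] by (simp add: lookup_single_times)

lemma lookup_const_times [simp]:
  fixes f :: "'a::comm_ring_1 poly3"
  shows "lookup (single 0 c * f) m = c * lookup f m"
  using lookup_single_times_add[of 0 c f m] by simp

text \<open>A ring homomorphism out of a monoid algebra, given on coefficients and on monomials. It
  covers evaluation at the coordinates of the parameter space, linear substitutions and
  dehomogenization.\<close>

locale evaluation =
  fixes c :: "'a::comm_ring_1 \<Rightarrow> 'r::comm_ring_1" and w :: "'m::comm_monoid_add \<Rightarrow> 'r"
  assumes c_add: "c (a + b) = c a + c b" and c_mult: "c (a * b) = c a * c b" and c_one: "c 1 = 1"
    and w_add: "w (m + n) = w m * w n" and w_zero: "w 0 = 1"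
begin

definition ev :: "('m \<Rightarrow>\<^sub>0 'a) \<Rightarrow> 'r" where
  "ev f = (\<Sum>m\<in>keys f. c (lookup f m) * w m)"

lemma c_zero: "c 0 = 0"
  using c_add[of 0 0] by simp

lemma ev_superset:
  assumes "finite A" "keys f \<subseteq> A"
  shows "ev f = (\<Sum>m\<in>A. c (lookup f m) * w m)"
  unfolding ev_def by (rule sum.mono_neutral_left[OF assms]) (auto simp: in_keys_iff c_zero)

lemma ev_add: "ev (f + g) = ev f + ev g"
proof -
  have k: "keys (f + g) \<subseteq> keys f \<union> keys g" by (rule keys_add)
  show ?thesis
    by (subst (1 2 3) ev_superset[of "keys f \<union> keys g"])
      (use k in \<open>auto simp: lookup_add c_add distrib_right sum.distrib\<close>)
qed

lemma ev_single: "ev (single m a) = c a * w m"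
  by (simp add: ev_def c_zero)

lemma ev_zero: "ev 0 = 0"
  by (simp add: ev_def)

lemma ev_one: "ev 1 = 1"
  using ev_single[of 0 1] by (simp add: c_one w_zero)

lemma ev_mult: "ev (f * g) = ev f * ev g"
proof (induction f rule: poly_mapping_induct)
  case zero
  then show ?case by (simp add: ev_zero)
next
  case (single m a)
  show ?case
    by (induction g rule: poly_mapping_induct)
      (auto simp: ev_zero ev_single mult_single c_mult w_add ev_add distrib_left distrib_right mult_ac)
next
  case (add f g)
  then show ?case by (simp add: distrib_right ev_add)
qed

lemma ev_power: "ev (f ^ n) = ev f ^ n"
  by (induction n) (auto simp: ev_one ev_mult)

lemma ev_uminus: "ev (- f) = - ev f"
  using ev_add[of f "- f"] by (simp add: ev_zero eq_neg_iff_add_eq_0 add.commute)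

lemma ev_diff: "ev (f - g) = ev f - ev g"
  using ev_add[of f "- g"] by (simp add: ev_uminus)

end

lemma evaluation_peval:
  fixes x :: "'v \<Rightarrow> 'a::comm_ring_1"
  shows "evaluation (\<lambda>a. a) (\<lambda>\<mu>. \<Prod>v\<in>keys \<mu>. x v ^ lookup \<mu> v)"
proof
  fix \<mu> \<nu> :: "'v \<Rightarrow>\<^sub>0 nat"
  have sup: "(\<Prod>v\<in>keys \<rho>. x v ^ lookup \<rho> v) = (\<Prod>v\<in>keys \<mu> \<union> keys \<nu>. x v ^ lookup \<rho> v)"
    if "keys \<rho> \<subseteq> keys \<mu> \<union> keys \<nu>" for \<rho> :: "'v \<Rightarrow>\<^sub>0 nat"
    by (rule prod.mono_neutral_left) (use that in \<open>auto simp: in_keys_iff\<close>)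
  have "keys (\<mu> + \<nu>) \<subseteq> keys \<mu> \<union> keys \<nu>" by (rule keys_add)
  then show "(\<Prod>v\<in>keys (\<mu> + \<nu>). x v ^ lookup (\<mu> + \<nu>) v)
      = (\<Prod>v\<in>keys \<mu>. x v ^ lookup \<mu> v) * (\<Prod>v\<in>keys \<nu>. x v ^ lookup \<nu> v)"
    unfolding sup[OF \<open>keys (\<mu> + \<nu>) \<subseteq> _\<close>] sup[OF Un_upper1] sup[OF Un_upper2]
    by (simp add: lookup_add power_add prod.distrib)
qed auto

lemma peval_eq_ev: "peval P x = evaluation.ev (\<lambda>a. a) (\<lambda>\<mu>. \<Prod>v\<in>keys \<mu>. x v ^ lookup \<mu> v) P"
  by (simp add: peval_def evaluation.ev_def[OF evaluation_peval])

lemma peval_add: "peval (P + Q) x = peval P x + peval Q x"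
  by (simp add: peval_eq_ev evaluation.ev_add[OF evaluation_peval])

lemma peval_mult: "peval (P * Q) x = peval P x * peval Q x"
  by (simp add: peval_eq_ev evaluation.ev_mult[OF evaluation_peval])

lemma peval_const: "peval (single 0 a) x = a"
  by (simp add: peval_eq_ev evaluation.ev_single[OF evaluation_peval])

lemma peval_var: "peval (single (single v 1) 1) x = x v"
  by (simp add: peval_eq_ev evaluation.ev_single[OF evaluation_peval])

section \<open>Homogeneous components\<close>

text \<open>\<open>Hom n d\<close> is the component of degree \<open>n - d\<close>, where a negative degree gives \<open>{0}\<close>.\<close>

definition Hom :: "nat \<Rightarrow> nat \<Rightarrow> 'a::zero poly3 set" where
  "Hom n d = {h. \<forall>m\<in>keys h. mdeg m + d = n}"

lemma homogeneous_iff_Hom: "homogeneous d f \<longleftrightarrow> f \<in> Hom d 0"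
  by (simp add: homogeneous_def Hom_def)

lemma mdeg_add [simp]: "mdeg (m + n) = mdeg m + mdeg n"
  by (cases m; cases n) (auto simp: mdeg_def)

lemma mdeg_zero [simp]: "mdeg 0 = 0"
  by (simp add: mdeg_def zero_prod_def)

lemma HomD: "h \<in> Hom n d \<Longrightarrow> lookup h m \<noteq> 0 \<Longrightarrow> mdeg m + d = n"
  by (auto simp: Hom_def in_keys_iff)

lemma Hom_zero [simp]: "0 \<in> Hom n d"
  by (simp add: Hom_def)

lemma Hom_single: "mdeg m + d = n \<Longrightarrow> single m c \<in> Hom n d"
  by (simp add: Hom_def)

lemma Hom_add: "f \<in> Hom n d \<Longrightarrow> g \<in> Hom n d \<Longrightarrow> f + g \<in> Hom n d"
  using keys_add[of f g] by (auto simp: Hom_def)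

lemma Hom_uminus: "f \<in> Hom n d \<Longrightarrow> - f \<in> Hom n d" for f :: "'a::ab_group_add poly3"
  by (auto simp: Hom_def)

lemma Hom_diff: "f \<in> Hom n d \<Longrightarrow> g \<in> Hom n d \<Longrightarrow> f - g \<in> Hom n d" for f :: "'a::ab_group_add poly3"
  using keys_diff_subset[of f g] by (auto simp: Hom_def)

lemma Hom_sum: "(\<And>k. k \<in> K \<Longrightarrow> f k \<in> Hom n d) \<Longrightarrow> (\<Sum>k\<in>K. f k) \<in> Hom n d"
  by (induction K rule: infinite_finite_induct) (auto intro: Hom_add)

lemma Hom_mult:
  fixes f :: "'a::comm_ring_1 poly3"
  assumes h: "h \<in> Hom n d" and f: "f \<in> Hom d d'"
  shows "h * f \<in> Hom n d'"
  unfolding Hom_def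
proof (intro CollectI ballI)
  fix m assume "m \<in> keys (h * f)"
  then obtain a b where m: "m = a + b" "a \<in> keys h" "b \<in> keys f" using keys_mult[of h f] by blast
  then have "mdeg a + d = n" "mdeg b + d' = d" using h f by (auto simp only: Hom_def)
  then show "mdeg m + d' = n" by (simp add: m(1))
qed

lemma Hom_const_times: "f \<in> Hom n d \<Longrightarrow> single 0 c * f \<in> Hom n d" for f :: "'a::comm_ring_1 poly3"
  by (auto simp: Hom_def in_keys_iff)

lemma Hom_shift: "f \<in> Hom (n + k) (d + k) \<longleftrightarrow> f \<in> Hom n d"
  by (auto simp: Hom_def)

definition hcomp :: "nat \<Rightarrow> nat \<Rightarrow> 'a::comm_monoid_add poly3 \<Rightarrow> 'a poly3" where
  "hcomp n d h = (\<Sum>m\<in>{m\<in>keys h. mdeg m + d = n}. single m (lookup h m))"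

lemma lookup_hcomp: "lookup (hcomp n d h) m = (if mdeg m + d = n then lookup h m else 0)"
  by (auto simp: hcomp_def lookup_sum lookup_single when_def in_keys_iff)

lemma hcomp_add: "hcomp n d (f + g) = hcomp n d f + hcomp n d g"
  by (rule poly_mapping_eqI) (simp add: lookup_hcomp lookup_add)

lemma hcomp_diff: "hcomp n d (f - g) = hcomp n d f - hcomp n d g" for f :: "'a::ab_group_add poly3"
  by (rule poly_mapping_eqI) (simp add: lookup_hcomp lookup_minus)

lemma hcomp_in_Hom: "hcomp n d f \<in> Hom n d"
  by (auto simp: Hom_def in_keys_iff lookup_hcomp split: if_splits)

lemma hcomp_Hom: "f \<in> Hom n d \<Longrightarrow> hcomp n d f = f"
  by (rule poly_mapping_eqI) (auto simp: lookup_hcomp dest: HomD)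

lemma hcomp_mult:
  fixes f :: "'a::comm_ring_1 poly3"
  assumes "f \<in> Hom d d'"
  shows "hcomp n d' (h * f) = hcomp n d h * f"
proof (induction h rule: poly_mapping_induct)
  case zero
  then show ?case by (simp add: hcomp_def)
next
  case (single m c)
  have f: "single m c * f \<in> Hom (mdeg m + d) d'"
    by (rule Hom_mult[OF Hom_single assms]) simp
  show ?case
  proof (cases "mdeg m + d = n")
    case True
    then show ?thesis using f by (simp add: hcomp_Hom Hom_single)
  next
    case False
    then have "hcomp n d' (single m c * f) = 0"
      using HomD[OF f] by (intro poly_mapping_eqI) (metis lookup_hcomp lookup_zero)
    moreover have "hcomp n d (single m c) = 0"
      using False by (intro poly_mapping_eqI) (auto simp: lookup_hcomp lookup_single when_def)
    ultimately show ?thesis by simp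
  qed
next
  case (add f g)
  then show ?case by (simp add: hcomp_add distrib_right)
qed

lemma finite_mdeg_eq [simp]: "finite {m. mdeg m + d = n}"
proof (rule finite_subset)
  show "{m. mdeg m + d = n} \<subseteq> {..n} \<times> {..n} \<times> {..n}"
    by (auto simp: mdeg_def)
qed auto

section \<open>Generic properties\<close>

definition polyfun :: "('a::comm_ring_1 poly3 \<times> 'a poly3 \<times> 'a poly3 \<Rightarrow> 'a) \<Rightarrow> bool" where
  "polyfun \<phi> \<longleftrightarrow> (\<exists>P. \<forall>f. \<phi> f = peval P (coord f))"

lemma polyfun_const: "polyfun (\<lambda>f. a)"
  unfolding polyfun_def by (metis peval_const)

lemma polyfun_add: "polyfun \<phi> \<Longrightarrow> polyfun \<psi> \<Longrightarrow> polyfun (\<lambda>f. \<phi> f + \<psi> f)"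
  unfolding polyfun_def by (metis peval_add)

lemma polyfun_mult: "polyfun \<phi> \<Longrightarrow> polyfun \<psi> \<Longrightarrow> polyfun (\<lambda>f. \<phi> f * \<psi> f)"
  unfolding polyfun_def by (metis peval_mult)

lemma polyfun_diff: "polyfun \<phi> \<Longrightarrow> polyfun \<psi> \<Longrightarrow> polyfun (\<lambda>f. \<phi> f - \<psi> f)"
  using polyfun_add[of \<phi> "\<lambda>f. - 1 * \<psi> f"] polyfun_mult[OF polyfun_const[of "- 1"], of \<psi>] by simp

lemma polyfun_coord: "polyfun (\<lambda>f. coord f v)"
  unfolding polyfun_def by (metis peval_var)

definition polyfam :: "('a::comm_ring_1 poly3 \<times> 'a poly3 \<times> 'a poly3 \<Rightarrow> 'a poly3) \<Rightarrow> bool" where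
  "polyfam p \<longleftrightarrow> (\<forall>m. polyfun (\<lambda>f. lookup (p f) m))"

lemma polyfam_const: "polyfam (\<lambda>f. g)"
  by (simp add: polyfam_def polyfun_const)

lemma polyfam_coords:
  "polyfam (fst :: 'a::comm_ring_1 poly3 \<times> 'a poly3 \<times> 'a poly3 \<Rightarrow> 'a poly3)"
  "polyfam (\<lambda>f :: 'a poly3 \<times> 'a poly3 \<times> 'a poly3. fst (snd f))"
  "polyfam (\<lambda>f :: 'a poly3 \<times> 'a poly3 \<times> 'a poly3. snd (snd f))"
proof -
  have c: "lookup (fst f) m = coord f (0, m)" "lookup (fst (snd f)) m = coord f (1, m)"
    "lookup (snd (snd f)) m = coord f (2, m)" for f :: "'a poly3 \<times> 'a poly3 \<times> 'a poly3" and m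
    by (auto simp: coord_def split: prod.split)
  show "polyfam (fst :: 'a poly3 \<times> 'a poly3 \<times> 'a poly3 \<Rightarrow> 'a poly3)"
    "polyfam (\<lambda>f :: 'a poly3 \<times> 'a poly3 \<times> 'a poly3. fst (snd f))"
    "polyfam (\<lambda>f :: 'a poly3 \<times> 'a poly3 \<times> 'a poly3. snd (snd f))"
    unfolding polyfam_def c by (simp_all only: polyfun_coord simp_thms)
qed

lemma polyfam_add: "polyfam p \<Longrightarrow> polyfam q \<Longrightarrow> polyfam (\<lambda>f. p f + q f)"
  by (simp add: polyfam_def lookup_add polyfun_add)

lemma polyfam_diff: "polyfam p \<Longrightarrow> polyfam q \<Longrightarrow> polyfam (\<lambda>f. p f - q f)"
  by (simp add: polyfam_def lookup_minus polyfun_diff)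

lemma polyfam_times:
  assumes "polyfam p"
  shows "polyfam (\<lambda>f. h * p f)"
proof (induction h rule: poly_mapping_induct)
  case (single n c)
  have "polyfun (\<lambda>f. if mdvd n m then c * lookup (p f) (m - n) else 0)" for m
    using polyfun_mult[OF polyfun_const[of c] assms[unfolded polyfam_def, rule_format, of "m - n"]]
    by (cases "mdvd n m") (simp_all add: polyfun_const)
  then show ?case by (simp add: polyfam_def lookup_single_times)
next
  case zero
  show ?case by (simp add: polyfam_const)
next
  case (add f g)
  then show ?case by (simp add: distrib_right polyfam_add)
qed

lemmas polyfam_intros = polyfam_const polyfam_coords polyfam_add polyfam_diff polyfam_times

lemma polyfam_lookup: "polyfam p \<Longrightarrow> polyfun (\<lambda>f. lookup (p f) m)"
  unfolding polyfam_def by (rule spec)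

text \<open>A nonempty basic open set on which \<open>Q\<close> holds. Conditions of this shape are
  combined by multiplying their functions.\<close>

definition principal_generic ::
  "nat \<Rightarrow> nat \<Rightarrow> nat \<Rightarrow> ('a::comm_ring_1 poly3 \<times> 'a poly3 \<times> 'a poly3 \<Rightarrow> bool) \<Rightarrow> bool" where
  "principal_generic d1 d2 d3 Q \<longleftrightarrow> (\<exists>\<phi>. polyfun \<phi> \<and> (\<exists>f\<in>hspace d1 d2 d3. \<phi> f \<noteq> 0) \<and>
     (\<forall>f\<in>hspace d1 d2 d3. \<phi> f \<noteq> 0 \<longrightarrow> Q f))"

lemma generic_if_principal_generic: "principal_generic d1 d2 d3 Q \<Longrightarrow> generic d1 d2 d3 Q"
proof -
  assume "principal_generic d1 d2 d3 Q"
  then obtain P where P: "\<exists>f\<in>hspace d1 d2 d3. peval P (coord f) \<noteq> 0"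
    "\<forall>f\<in>hspace d1 d2 d3. peval P (coord f) \<noteq> 0 \<longrightarrow> Q f"
    unfolding principal_generic_def polyfun_def by metis
  let ?U = "{f \<in> hspace d1 d2 d3. \<exists>P\<in>{P}. peval P (coord f) \<noteq> 0}"
  have "zariski_open d1 d2 d3 ?U" unfolding zariski_open_def by blast
  moreover have "?U \<noteq> {}" "\<forall>f\<in>?U. Q f" using P by auto
  ultimately show ?thesis unfolding generic_def by blast
qed

lemma principal_generic_mono:
  "principal_generic d1 d2 d3 Q \<Longrightarrow> (\<And>f. f \<in> hspace d1 d2 d3 \<Longrightarrow> Q f \<Longrightarrow> R f) \<Longrightarrow> principal_generic d1 d2 d3 R"
  unfolding principal_generic_def by blast

section \<open>Lines in the parameter space and intersections of open conditions\<close>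

definition segment :: "'a::comm_ring_1 poly3 \<times> 'a poly3 \<times> 'a poly3 \<Rightarrow> 'a poly3 \<times> 'a poly3 \<times> 'a poly3
    \<Rightarrow> 'a \<Rightarrow> 'a poly3 \<times> 'a poly3 \<times> 'a poly3" where
  "segment f g t = (single 0 (1 - t) * fst f + single 0 t * fst g,
     single 0 (1 - t) * fst (snd f) + single 0 t * fst (snd g),
     single 0 (1 - t) * snd (snd f) + single 0 t * snd (snd g))"

lemma segment_endpoints [simp]: "segment f g 0 = f" "segment f g 1 = g"
  by (simp_all add: segment_def)

lemma segment_in_hspace:
  "f \<in> hspace d1 d2 d3 \<Longrightarrow> g \<in> hspace d1 d2 d3 \<Longrightarrow> segment f g t \<in> hspace d1 d2 d3"
  unfolding hspace_def homogeneous_iff_Hom segment_def by (auto intro!: Hom_add Hom_const_times)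

lemma coord_segment: "coord (segment f g t) v = (1 - t) * coord f v + t * coord g v"
proof -
  obtain i m where v: "v = (i, m)" by (cases v)
  show ?thesis
    unfolding v by (cases f; cases g) (simp add: coord_def segment_def lookup_add)
qed

lemma polyfun_segment:
  assumes "polyfun \<phi>"
  obtains p where "\<And>t. \<phi> (segment f g t) = poly p t"
proof -
  obtain P where P: "\<And>f. \<phi> f = peval P (coord f)" using assms unfolding polyfun_def by blast
  define p where "p = (\<Sum>\<mu>\<in>keys P. smult (lookup P \<mu>)
    (\<Prod>v\<in>keys \<mu>. [:coord f v, coord g v - coord f v:] ^ lookup \<mu> v))"
  have c: "coord (segment f g t) v = coord f v + t * (coord g v - coord f v)" for t v
    unfolding coord_segment by (simp add: algebra_simps)
  have "\<phi> (segment f g t) = poly p t" for t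
    unfolding P peval_def p_def by (simp add: poly_sum poly_prod poly_power c)
  then show ?thesis by (rule that)
qed

text \<open>Affine space over an infinite field is irreducible: on the line through the two
  witnesses both functions become nonzero polynomials in one variable, and some parameter avoids the
  roots of both.\<close>

lemma principal_generic_conj:
  fixes Q :: "'a::field_char_0 poly3 \<times> 'a poly3 \<times> 'a poly3 \<Rightarrow> bool"
  assumes "principal_generic d1 d2 d3 Q" "principal_generic d1 d2 d3 R"
  shows "principal_generic d1 d2 d3 (\<lambda>f. Q f \<and> R f)"
proof -
  from assms obtain \<phi> \<psi> f g where \<phi>: "polyfun \<phi>" "f \<in> hspace d1 d2 d3" "\<phi> f \<noteq> 0"
    "\<forall>f\<in>hspace d1 d2 d3. \<phi> f \<noteq> 0 \<longrightarrow> Q f"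
    and \<psi>: "polyfun \<psi>" "g \<in> hspace d1 d2 d3" "\<psi> g \<noteq> 0"
    "\<forall>f\<in>hspace d1 d2 d3. \<psi> f \<noteq> 0 \<longrightarrow> R f"
    unfolding principal_generic_def by blast
  obtain p where p: "\<And>t. \<phi> (segment f g t) = poly p t" by (rule polyfun_segment[OF \<phi>(1), of f g]) blast
  obtain q where q: "\<And>t. \<psi> (segment f g t) = poly q t" by (rule polyfun_segment[OF \<psi>(1), of f g]) blast
  have "p \<noteq> 0" "q \<noteq> 0" using p[of 0] q[of 1] \<phi>(3) \<psi>(3) by auto
  then have "finite {t. poly (p * q) t = 0}" by (intro poly_roots_finite) simp
  then obtain t where t: "poly (p * q) t \<noteq> 0"
    using infinite_UNIV_char_0[where 'a = 'a] by (cases "\<forall>t. poly (p * q) t = 0") (auto simp del: poly_mult mult_eq_0_iff)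
  let ?h = "segment f g t"
  have "?h \<in> hspace d1 d2 d3" "\<phi> ?h * \<psi> ?h \<noteq> 0"
    using segment_in_hspace[OF \<phi>(2) \<psi>(2)] t by (simp_all add: p q)
  then show ?thesis
    unfolding principal_generic_def using \<phi>(4) \<psi>(4) polyfun_mult[OF \<phi>(1) \<psi>(1)]
    by (intro exI[of _ "\<lambda>f. \<phi> f * \<psi> f"]) auto
qed

lemma principal_generic_True: "principal_generic d1 d2 d3 (\<lambda>f. True)"
  unfolding principal_generic_def
  by (intro exI[of _ "\<lambda>f. 1"] conjI polyfun_const bexI[of _ "(0, 0, 0)"])
    (auto simp: hspace_def homogeneous_iff_Hom)

lemma principal_generic_ball:
  fixes Q :: "'i \<Rightarrow> 'a::field_char_0 poly3 \<times> 'a poly3 \<times> 'a poly3 \<Rightarrow> bool"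
  assumes "finite A" "\<And>i. i \<in> A \<Longrightarrow> principal_generic d1 d2 d3 (Q i)"
  shows "principal_generic d1 d2 d3 (\<lambda>f. \<forall>i\<in>A. Q i f)"
  using assms
proof (induction A rule: finite_induct)
  case empty
  then show ?case by (simp add: principal_generic_True)
next
  case (insert i A)
  then have "principal_generic d1 d2 d3 (\<lambda>f. Q i f \<and> (\<forall>i\<in>A. Q i f))"
    by (intro principal_generic_conj) auto
  then show ?case by simp
qed

text \<open>The function \<open>\<phi>\<close> is the product of the pivots of an elimination whose
  pivot positions are chosen at \<open>f0\<close>. Wherever none of them vanishes the same
  elimination goes through and certifies independence.\<close>

lemma polyfun_indep:
  fixes v :: "'a::field poly3 \<times> 'a poly3 \<times> 'a poly3 \<Rightarrow> 'k \<Rightarrow> 'b \<Rightarrow> 'a"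
  assumes "finite K" "\<And>k b. k \<in> K \<Longrightarrow> polyfun (\<lambda>f. v f k b)" "indep K (v f0)"
  obtains \<phi> where "polyfun \<phi>" "\<phi> f0 \<noteq> 0" "\<And>f. \<phi> f \<noteq> 0 \<Longrightarrow> indep K (v f)"
proof -
  have "\<exists>\<phi>. polyfun \<phi> \<and> \<phi> f0 \<noteq> 0 \<and> (\<forall>f. \<phi> f \<noteq> 0 \<longrightarrow> indep K (v f))"
    using assms
  proof (induction K arbitrary: v rule: finite_induct)
    case empty
    then show ?case by (intro exI[of _ "\<lambda>f. 1"]) (simp add: polyfun_const)
  next
    case (insert k0 K)
    obtain b0 where b0: "v f0 k0 b0 \<noteq> 0"
      by (rule indep_insert_nonzero[OF insert.hyps(1) insert.prems(2)])
    let ?w = "\<lambda>f k b. v f k0 b0 * v f k b - v f k b0 * v f k0 b"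
    have "\<exists>\<phi>. polyfun \<phi> \<and> \<phi> f0 \<noteq> 0 \<and> (\<forall>f. \<phi> f \<noteq> 0 \<longrightarrow> indep K (?w f))"
    proof (rule insert.IH)
      show "indep K (?w f0)"
        using indep_eliminate[where v = "v f0", OF insert.hyps b0] insert.prems(2) by simp
      show "polyfun (\<lambda>f. ?w f k b)" if "k \<in> K" for k b
        using insert.prems(1) that by (intro polyfun_diff polyfun_mult) auto
    qed
    then obtain \<phi> where \<phi>: "polyfun \<phi>" "\<phi> f0 \<noteq> 0" "\<And>f. \<phi> f \<noteq> 0 \<Longrightarrow> indep K (?w f)" by blast
    have "indep (insert k0 K) (v f)" if "\<phi> f \<noteq> 0" "v f k0 b0 \<noteq> 0" for f
      using indep_eliminate[where v = "v f", OF insert.hyps that(2)] \<phi>(3)[OF that(1)] by simp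
    moreover have "polyfun (\<lambda>f. \<phi> f * v f k0 b0)"
      using \<phi>(1) insert.prems(1) by (intro polyfun_mult) auto
    ultimately show ?case
      using \<phi>(2) b0 by (intro exI[of _ "\<lambda>f. \<phi> f * v f k0 b0"]) auto
  qed
  then obtain \<phi> where \<phi>: "polyfun \<phi>" "\<phi> f0 \<noteq> 0" "\<forall>f. \<phi> f \<noteq> 0 \<longrightarrow> indep K (v f)" by blast
  show ?thesis by (rule that[OF \<phi>(1,2)]) (use \<phi>(3) in blast)
qed

lemma principal_generic_indep:
  fixes v :: "'a::field poly3 \<times> 'a poly3 \<times> 'a poly3 \<Rightarrow> 'k \<Rightarrow> 'b \<Rightarrow> 'a"
  assumes "finite K" "\<And>k b. k \<in> K \<Longrightarrow> polyfun (\<lambda>f. v f k b)" "f0 \<in> hspace d1 d2 d3" "indep K (v f0)"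
  shows "principal_generic d1 d2 d3 (\<lambda>f. indep K (v f))"
proof -
  show ?thesis
  proof (rule polyfun_indep[where v = v, OF assms(1,2,4)])
    fix \<phi> assume "polyfun \<phi>" "\<phi> f0 \<noteq> 0" "\<And>f. \<phi> f \<noteq> 0 \<Longrightarrow> indep K (v f)"
    then show ?thesis unfolding principal_generic_def using assms(3) by blast
  qed
qed

section \<open>The strong Lefschetz property of a monomial complete intersection\<close>

definition X1 :: "'a::comm_ring_1 poly3" where "X1 = single (1, 0, 0) 1"
definition X2 :: "'a::comm_ring_1 poly3" where "X2 = single (0, 1, 0) 1"
definition X3 :: "'a::comm_ring_1 poly3" where "X3 = single (0, 0, 1) 1"

lemma single_zero_one: "single (0, 0, 0) 1 = (1 :: 'a::comm_ring_1 poly3)"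
  by (simp flip: single_one zero_prod_def)

lemma X_power: "X1 ^ n = single (n, 0, 0) 1" "X2 ^ n = single (0, n, 0) 1" "X3 ^ n = single (0, 0, n) 1"
  by (induction n) (simp_all add: X1_def X2_def X3_def mult_single single_zero_one)

lemma lookup_X_power_times:
  "lookup (X1 ^ n * f) (a, b, c) = (if n \<le> a then lookup f (a - n, b, c) else 0)"
  "lookup (X2 ^ n * f) (a, b, c) = (if n \<le> b then lookup f (a, b - n, c) else 0)"
  "lookup (X3 ^ n * f) (a, b, c) = (if n \<le> c then lookup f (a, b, c - n) else 0)"
  by (simp_all add: X_power lookup_single_times mdvd_def)

lemma X_power_Hom: "X1 ^ n \<in> Hom n 0" "X2 ^ n \<in> Hom n 0" "X3 ^ n \<in> Hom n 0"
  by (simp_all add: X_power Hom_single mdeg_def)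

lemma Hom_power: "f \<in> Hom 1 0 \<Longrightarrow> f ^ k \<in> Hom (k + n) n" for f :: "'a::comm_ring_1 poly3"
proof (induction k)
  case 0
  then show ?case by (simp add: Hom_def)
next
  case (Suc k)
  then have "f * f ^ k \<in> Hom (Suc k + n) n"
    using Hom_shift[of f 1 "k + n" 0] by (intro Hom_mult[of f _ "k + n"]) auto
  then show ?case by simp
qed

lemma X_Hom: "X1 \<in> Hom 1 0" "X2 \<in> Hom 1 0" "X3 \<in> Hom 1 0"
  by (simp_all add: X1_def X2_def X3_def Hom_single mdeg_def)

lemma linear_form_power_Hom: "(X1 + X2 + X3) ^ k \<in> Hom (k + n) n"
  by (intro Hom_power Hom_add X_Hom)

section \<open>The sl2 action on the monomial complete intersection\<close>

definition raise :: "(mono3 \<Rightarrow> 'a::comm_ring_1) \<Rightarrow> mono3 \<Rightarrow> 'a" where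
  "raise F = (\<lambda>(a, b, c). (case a of 0 \<Rightarrow> 0 | Suc a' \<Rightarrow> F (a', b, c)) +
     (case b of 0 \<Rightarrow> 0 | Suc b' \<Rightarrow> F (a, b', c)) + (case c of 0 \<Rightarrow> 0 | Suc c' \<Rightarrow> F (a, b, c')))"

lemma lookup_linear_form_times: "lookup ((X1 + X2 + X3) * f) = raise (lookup f)"
proof
  fix m :: mono3
  obtain a b c where m: "m = (a, b, c)" by (cases m)
  show "lookup ((X1 + X2 + X3) * f) m = raise (lookup f) m"
    using lookup_X_power_times[of 1 f a b c]
    by (auto simp: m distrib_right lookup_add raise_def split: nat.split)
qed

lemma lookup_linear_form_power_times:
  "lookup ((X1 + X2 + X3) ^ k * f) = (raise ^^ k) (lookup f)"
  by (induction k) (simp_all add: mult.assoc lookup_linear_form_times)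

text \<open>Together with \<open>raise\<close>, the operator \<open>\<Sum>k. (dk - 1) \<partial>/\<partial>xk - xk \<partial>^2/\<partial>xk^2\<close> spans a copy of
  \<open>sl2\<close>, and it preserves the ideal generated by the powers \<open>xk^dk\<close>.\<close>

definition lower :: "nat \<Rightarrow> nat \<Rightarrow> nat \<Rightarrow> (mono3 \<Rightarrow> 'a::comm_ring_1) \<Rightarrow> mono3 \<Rightarrow> 'a" where
  "lower d1 d2 d3 F = (\<lambda>(a, b, c). of_nat (a + 1) * (of_nat d1 - of_nat (a + 1)) * F (a + 1, b, c) +
     of_nat (b + 1) * (of_nat d2 - of_nat (b + 1)) * F (a, b + 1, c) +
     of_nat (c + 1) * (of_nat d3 - of_nat (c + 1)) * F (a, b, c + 1))"

lemma raise_linear: "raise (\<lambda>m. F m + x * G m) m = raise F m + x * raise G m"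
  by (cases m) (simp add: raise_def algebra_simps split: nat.split)

text \<open>The commutator of the two operators is the weight operator: for
  \<open>d1 + d2 + d3 = e + 3\<close>, a monomial of degree i has weight e - 2i.\<close>

lemma lower_raise:
  "lower d1 d2 d3 (raise F) m =
     raise (lower d1 d2 d3 F) m + (of_nat (d1 + d2 + d3) - 3 - 2 * of_nat (mdeg m)) * F m"
proof -
  obtain a b c where m: "m = (a, b, c)" by (cases m)
  show ?thesis
    unfolding m by (cases a; cases b; cases c) (simp_all add: raise_def lower_def mdeg_def algebra_simps)
qed

definition supported_in :: "nat \<Rightarrow> (mono3 \<Rightarrow> 'a::zero) \<Rightarrow> bool" where
  "supported_in i F \<longleftrightarrow> (\<forall>a b c. a + b + c \<noteq> i \<longrightarrow> F (a, b, c) = 0)"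

lemma supported_in_raise: "supported_in i F \<Longrightarrow> supported_in (Suc i) (raise F)"
  unfolding supported_in_def
  by (auto simp: raise_def split: nat.split)

lemma supported_in_raise_power: "supported_in i F \<Longrightarrow> supported_in (i + k) ((raise ^^ k) F)"
  by (induction k) (auto dest: supported_in_raise)

lemma supported_in_lower: "supported_in (Suc i) F \<Longrightarrow> supported_in i (lower d1 d2 d3 F)"
  unfolding supported_in_def by (auto simp: lower_def)

lemma lower_supported_in_0: "supported_in 0 F \<Longrightarrow> lower d1 d2 d3 F = (\<lambda>m. 0)"
  unfolding supported_in_def by (auto simp: lower_def)

text \<open>The weights along the chain add up: the sum of e - 2(i + l) over l < k equals k(e - 2i -
  k + 1). For k = 0 this factor is zero, so the truncated exponent \<open>k - 1\<close> is
  harmless.\<close>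

lemma lower_raise_power:
  fixes F :: "mono3 \<Rightarrow> 'a::comm_ring_1"
  assumes F: "supported_in i F" and e: "d1 + d2 + d3 = e + 3"
  shows "lower d1 d2 d3 ((raise ^^ k) F) m = (raise ^^ k) (lower d1 d2 d3 F) m +
    of_nat k * (of_nat e - 2 * of_nat i - of_nat k + 1) * (raise ^^ (k - 1)) F m"
proof (induction k arbitrary: m)
  case 0
  then show ?case by simp
next
  case (Suc k)
  let ?G = "(raise ^^ k) F"
  let ?x = "of_nat k * (of_nat e - 2 * of_nat i - of_nat k + 1) :: 'a"
  have "lower d1 d2 d3 (raise ?G) m = raise (lower d1 d2 d3 ?G) m
      + (of_nat (d1 + d2 + d3) - 3 - 2 * of_nat (mdeg m)) * ?G m"
    by (rule lower_raise)
  also have "(of_nat (d1 + d2 + d3) - 3 - 2 * of_nat (mdeg m)) * ?G m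
      = (of_nat e - 2 * of_nat (i + k)) * ?G m"
  proof (cases "?G m = 0")
    case False
    then have "mdeg m = i + k"
      using supported_in_raise_power[OF F, of k] unfolding supported_in_def by (cases m) (auto simp: mdeg_def)
    then show ?thesis by (simp add: e)
  qed simp
  also have "lower d1 d2 d3 ?G = (\<lambda>m. (raise ^^ k) (lower d1 d2 d3 F) m + ?x * (raise ^^ (k - 1)) F m)"
    using Suc.IH by blast
  also have "raise \<dots> m = raise ((raise ^^ k) (lower d1 d2 d3 F)) m + ?x * raise ((raise ^^ (k - 1)) F) m"
    by (rule raise_linear)
  also have "?x * raise ((raise ^^ (k - 1)) F) m = ?x * ?G m"
    by (cases k) auto
  finally show ?case by (simp add: algebra_simps)
qed

text \<open>The monomials inside the box form a basis of the quotient by the powers of the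
  variables, so this is membership in that ideal, read off coefficients.\<close>

definition vanishes_on_box :: "nat \<Rightarrow> nat \<Rightarrow> nat \<Rightarrow> (mono3 \<Rightarrow> 'a::zero) \<Rightarrow> bool" where
  "vanishes_on_box d1 d2 d3 F \<longleftrightarrow> (\<forall>a<d1. \<forall>b<d2. \<forall>c<d3. F (a, b, c) = 0)"

lemma vanishes_on_box_raise: "vanishes_on_box d1 d2 d3 F \<Longrightarrow> vanishes_on_box d1 d2 d3 (raise F)"
  unfolding vanishes_on_box_def raise_def by (auto split: nat.split)

lemma vanishes_on_box_raise_power:
  "vanishes_on_box d1 d2 d3 F \<Longrightarrow> vanishes_on_box d1 d2 d3 ((raise ^^ k) F)"
  by (induction k) (auto intro: vanishes_on_box_raise)

text \<open>A neighbour of a box point leaves the box only when the increased exponent equals its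
  bound, and there the factor such as \<open>of_nat d1 - of_nat (a + 1)\<close> is zero. So the
  operator descends to the quotient.\<close>

lemma vanishes_on_box_lower: 
  assumes "vanishes_on_box d1 d2 d3 F" shows "vanishes_on_box d1 d2 d3 (lower d1 d2 d3 F)"
proof -
  have *: "of_nat (a + 1) * (of_nat d - of_nat (a + 1)) * y = 0"
    if "a < d" "a + 1 < d \<Longrightarrow> y = 0" for a d :: nat and y :: 'a
    using that by (cases "a + 1 = d") auto
  show ?thesis
    unfolding vanishes_on_box_def lower_def prod.case
  proof (intro allI impI)
    fix a b c assume box: "a < d1" "b < d2" "c < d3"
    then show "of_nat (a + 1) * (of_nat d1 - of_nat (a + 1)) * F (a + 1, b, c) +
        of_nat (b + 1) * (of_nat d2 - of_nat (b + 1)) * F (a, b + 1, c) +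
        of_nat (c + 1) * (of_nat d3 - of_nat (c + 1)) * F (a, b, c + 1) = 0"
      using *[OF box(1), of "F (a + 1, b, c)"] *[OF box(2), of "F (a, b + 1, c)"]
        *[OF box(3), of "F (a, b, c + 1)"] assms
      unfolding vanishes_on_box_def by (simp del: of_nat_add)
  qed
qed

text \<open>Modulo the ideal, \<open>F\<close> is shown to be primitive by induction on i:
  \<open>lower\<close> sends it to degree i - 1, into the kernel of the matching power with exponent
  \<open>k + 2\<close>. A primitive element is recovered, up to a nonzero scalar, from each of its
  images under the powers up to k.\<close>

theorem strong_Lefschetz_injective:
  fixes F :: "mono3 \<Rightarrow> 'a::field_char_0"
  assumes e: "d1 + d2 + d3 = e + 3"
    and "2 * i + k = e" "supported_in i F" "vanishes_on_box d1 d2 d3 ((raise ^^ k) F)"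
  shows "vanishes_on_box d1 d2 d3 F"
  using assms(2-)
proof (induction i arbitrary: F k)
  have descend: "vanishes_on_box d1 d2 d3 F"
    if k: "2 * i + k = e" and F: "supported_in i F"
      and V: "vanishes_on_box d1 d2 d3 ((raise ^^ k) F)"
      and DF: "vanishes_on_box d1 d2 d3 (lower d1 d2 d3 F)" for i k and F :: "mono3 \<Rightarrow> 'a"
  proof -
    have "j \<le> k \<Longrightarrow> vanishes_on_box d1 d2 d3 ((raise ^^ j) F) \<Longrightarrow> vanishes_on_box d1 d2 d3 F" for j
    proof (induction j)
      case (Suc j)
      \<comment> \<open>The scalar of \<open>lower_raise_power\<close> becomes (j + 1)(k - j), which
        is nonzero for j < k in characteristic zero.\<close>
      have "of_nat e - 2 * of_nat i - of_nat (Suc j) + 1 = (of_nat (k - j) :: 'a)"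
        using Suc.prems(1) by (simp add: of_nat_diff flip: k)
      then have c: "of_nat (Suc j) * (of_nat e - 2 * of_nat i - of_nat (Suc j) + 1) \<noteq> (0 :: 'a)"
        using Suc.prems(1) by (simp del: of_nat_Suc)
      have "vanishes_on_box d1 d2 d3 ((raise ^^ j) F)"
        unfolding vanishes_on_box_def
      proof (intro allI impI)
        fix a b c assume box: "a < d1" "b < d2" "c < d3"
        have "lower d1 d2 d3 ((raise ^^ Suc j) F) (a, b, c) = 0"
          "(raise ^^ Suc j) (lower d1 d2 d3 F) (a, b, c) = 0"
          using vanishes_on_box_lower[OF Suc.prems(2)] vanishes_on_box_raise_power[OF DF, of "Suc j"] box
          unfolding vanishes_on_box_def by blast+
        then show "(raise ^^ j) F (a, b, c) = 0"
          using lower_raise_power[OF F e, of "Suc j" "(a, b, c)"] c by (simp del: of_nat_Suc)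
      qed
      then show ?case using Suc by simp
    qed simp
    then show ?thesis using V by blast
  qed
  {
    case 0
    have "lower d1 d2 d3 F = (\<lambda>m. 0)" by (rule lower_supported_in_0[OF 0(2)])
    then show ?case by (intro descend[OF 0]) (simp add: vanishes_on_box_def)
  next
    case (Suc i)
    note F = Suc.prems(2) and V = Suc.prems(3)
    have V': "vanishes_on_box d1 d2 d3 ((raise ^^ (k + 2)) (lower d1 d2 d3 F))"
    proof -
      \<comment> \<open>At exponent k + 1 the scalar is exactly zero, so \<open>lower\<close>
        commutes with this power of \<open>raise\<close> on \<open>F\<close>; one more
        \<open>raise\<close> gives the exponent k + 2 that belongs to degree i.\<close>
      have "of_nat e - 2 * of_nat (Suc i) - of_nat (Suc k) + 1 = (0 :: 'a)"
        by (simp flip: Suc.prems(1))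
      then have "lower d1 d2 d3 ((raise ^^ Suc k) F) m = (raise ^^ Suc k) (lower d1 d2 d3 F) m" for m
        using lower_raise_power[OF F e, of "Suc k" m] by simp
      then have "(raise ^^ Suc k) (lower d1 d2 d3 F) = lower d1 d2 d3 (raise ((raise ^^ k) F))"
        by auto
      with V have "vanishes_on_box d1 d2 d3 ((raise ^^ Suc k) (lower d1 d2 d3 F))"
        using vanishes_on_box_lower[OF vanishes_on_box_raise] by metis
      from vanishes_on_box_raise[OF this] show ?thesis by simp
    qed
    have "vanishes_on_box d1 d2 d3 (lower d1 d2 d3 F)"
      by (rule Suc.IH[OF _ supported_in_lower[OF F] V']) (use Suc.prems(1) in simp)
    then show ?case using descend[OF Suc.prems] by blast
  }
qed

section \<open>Ideals with three generators, monomial ideals and Koszul relations\<close>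

lemma gen_ideal3_zero: "0 \<in> gen_ideal3 f1 f2 f3"
  unfolding gen_ideal3_def by (intro CollectI exI[of _ 0]) simp

lemma gen_ideal3_add: "g \<in> gen_ideal3 f1 f2 f3 \<Longrightarrow> h \<in> gen_ideal3 f1 f2 f3 \<Longrightarrow> g + h \<in> gen_ideal3 f1 f2 f3"
proof -
  assume "g \<in> gen_ideal3 f1 f2 f3" "h \<in> gen_ideal3 f1 f2 f3"
  then obtain a1 a2 a3 b1 b2 b3 where "g = a1 * f1 + a2 * f2 + a3 * f3" "h = b1 * f1 + b2 * f2 + b3 * f3"
    unfolding gen_ideal3_def by blast
  then have "g + h = (a1 + b1) * f1 + (a2 + b2) * f2 + (a3 + b3) * f3"
    by (simp add: algebra_simps)
  then show ?thesis unfolding gen_ideal3_def by blast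
qed

lemma gen_ideal3_mult: "g \<in> gen_ideal3 f1 f2 f3 \<Longrightarrow> h * g \<in> gen_ideal3 f1 f2 f3"
proof -
  assume "g \<in> gen_ideal3 f1 f2 f3"
  then obtain a1 a2 a3 where "g = a1 * f1 + a2 * f2 + a3 * f3"
    unfolding gen_ideal3_def by blast
  then have "h * g = (h * a1) * f1 + (h * a2) * f2 + (h * a3) * f3"
    by (simp add: algebra_simps)
  then show ?thesis unfolding gen_ideal3_def by blast
qed

lemma gen_ideal3_sum: "(\<And>k. k \<in> K \<Longrightarrow> g k \<in> gen_ideal3 f1 f2 f3) \<Longrightarrow> (\<Sum>k\<in>K. g k) \<in> gen_ideal3 f1 f2 f3"
  by (induction K rule: infinite_finite_induct) (auto intro: gen_ideal3_add gen_ideal3_zero)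

lemma gen_ideal3_generators: "f1 \<in> gen_ideal3 f1 f2 f3" "f2 \<in> gen_ideal3 f1 f2 f3" "f3 \<in> gen_ideal3 f1 f2 f3"
proof -
  have "f1 = 1 * f1 + 0 * f2 + 0 * f3" "f2 = 0 * f1 + 1 * f2 + 0 * f3" "f3 = 0 * f1 + 0 * f2 + 1 * f3"
    by simp_all
  then show "f1 \<in> gen_ideal3 f1 f2 f3" "f2 \<in> gen_ideal3 f1 f2 f3" "f3 \<in> gen_ideal3 f1 f2 f3"
    unfolding gen_ideal3_def by blast+
qed

lemma gen_ideal3_monomialsI:
  fixes g :: "'a::comm_ring_1 poly3"
  assumes "\<And>m. m \<in> keys g \<Longrightarrow> mdvd n1 m \<or> mdvd n2 m \<or> mdvd n3 m"
  shows "g \<in> gen_ideal3 (single n1 1) (single n2 1) (single n3 1)" (is "g \<in> ?I")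
proof -
  have dvd: "single m c \<in> ?I" if "mdvd n m" "single n 1 \<in> ?I" for n m and c :: 'a
  proof -
    have "n + (m - n) = m" using that(1) mdvd_add_iff[of n m "m - n"] by simp
    then have "single m c = single (m - n) c * single n 1"
      by (simp add: mult_single add.commute)
    then show ?thesis using gen_ideal3_mult[OF that(2), of "single (m - n) c"] by simp
  qed
  have "single m (lookup g m) \<in> ?I" if "m \<in> keys g" for m
    using assms[OF that] by (auto intro: dvd simp: gen_ideal3_generators)
  then have "(\<Sum>m\<in>keys g. single m (lookup g m)) \<in> ?I"
    by (rule gen_ideal3_sum)
  then show ?thesis by (simp flip: poly_mapping_sum_single)
qed

lemma gen_ideal3_X_power_iff:
  "g \<in> gen_ideal3 (X1 ^ d1) (X2 ^ d2) (X3 ^ d3) \<longleftrightarrow> vanishes_on_box d1 d2 d3 (lookup g)"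
proof
  assume "g \<in> gen_ideal3 (X1 ^ d1) (X2 ^ d2) (X3 ^ d3)"
  then obtain h1 h2 h3 where "g = h1 * X1 ^ d1 + h2 * X2 ^ d2 + h3 * X3 ^ d3"
    unfolding gen_ideal3_def by blast
  then have "g = X1 ^ d1 * h1 + X2 ^ d2 * h2 + X3 ^ d3 * h3" by (simp add: mult.commute)
  then show "vanishes_on_box d1 d2 d3 (lookup g)"
    by (simp add: vanishes_on_box_def lookup_add lookup_X_power_times)
next
  assume v: "vanishes_on_box d1 d2 d3 (lookup g)"
  show "g \<in> gen_ideal3 (X1 ^ d1) (X2 ^ d2) (X3 ^ d3)"
    unfolding X_power
  proof (rule gen_ideal3_monomialsI)
    fix m assume mk: "m \<in> keys g"
    obtain a b c where m: "m = (a, b, c)" by (cases m)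
    have "d1 \<le> a \<or> d2 \<le> b \<or> d3 \<le> c"
    proof (rule ccontr)
      assume "\<not> ?thesis"
      then have "lookup g m = 0" using v by (simp add: m vanishes_on_box_def)
      then show False using mk by (simp add: in_keys_iff)
    qed
    then show "mdvd (d1, 0, 0) m \<or> mdvd (0, d2, 0) m \<or> mdvd (0, 0, d3) m"
      by (simp add: mdvd_def m)
  qed
qed

lemma high_degree_in_ideal_y:
  assumes "d1 + d2 + d3 = e + 3" "e < n" "s \<in> Hom n 0"
  shows "s \<in> gen_ideal3 (X1 ^ d1) (X2 ^ d2) (X3 ^ d3)"
  unfolding gen_ideal3_X_power_iff vanishes_on_box_def
proof (intro allI impI)
  fix a b c assume "a < d1" "b < d2" "c < d3"
  then have "mdeg (a, b, c) + 0 \<noteq> n" using assms(1,2) by (simp add: mdeg_def)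
  then show "lookup s (a, b, c) = 0" using HomD[OF assms(3)] by blast
qed

text \<open>Exactness of the Koszul complex for powers of the variables, by reading coefficients:
  the relation forces \<open>h3\<close> into the ideal of the first two powers, and after
  subtracting the matching Koszul relations a relation between two powers remains. Ideals with fewer
  generators are written in \<open>gen_ideal3\<close> by repeating one.\<close>

lemma koszul_y:
  assumes z: "h1 * X1 ^ d1 + h2 * X2 ^ d2 + h3 * X3 ^ d3 = 0"
  obtains u v w where "h1 = u * X2 ^ d2 + v * X3 ^ d3" "h2 = - u * X1 ^ d1 + w * X3 ^ d3"
    "h3 = - v * X1 ^ d1 - w * X2 ^ d2"
proof -
  have z': "lookup (X1 ^ d1 * h1) m + lookup (X2 ^ d2 * h2) m + lookup (X3 ^ d3 * h3) m = 0" for m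
    using z by (simp flip: lookup_add add: mult.commute)
  have "h3 \<in> gen_ideal3 (X1 ^ d1) (X2 ^ d2) (X2 ^ d2)"
    unfolding X_power
  proof (rule gen_ideal3_monomialsI)
    fix m assume mk: "m \<in> keys h3"
    obtain a b c where m: "m = (a, b, c)" by (cases m)
    \<comment> \<open>At an index with a < d1 and b < d2 the first two products contribute nothing,
      so the coefficient of \<open>h3\<close> would have to vanish.\<close>
    have "d1 \<le> a \<or> d2 \<le> b"
      using z'[of "(a, b, c + d3)"] mk by (auto simp: lookup_X_power_times m in_keys_iff not_le split: if_splits)
    then show "mdvd (d1, 0, 0) m \<or> mdvd (0, d2, 0) m \<or> mdvd (0, d2, 0) m"
      by (simp add: mdvd_def m)
  qed
  then obtain v w1 w2 where "h3 = v * X1 ^ d1 + w1 * X2 ^ d2 + w2 * X2 ^ d2"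
    unfolding gen_ideal3_def by blast
  then have h3: "h3 = v * X1 ^ d1 + (w1 + w2) * X2 ^ d2" by (simp add: distrib_right)
  define w where "w = w1 + w2"
  define p where "p = h1 + v * X3 ^ d3"
  define q where "q = h2 + w * X3 ^ d3"
  have pq: "X1 ^ d1 * p + X2 ^ d2 * q = 0"
    using z unfolding h3 p_def q_def w_def by (simp add: algebra_simps)
  then have pq': "lookup (X1 ^ d1 * p) m + lookup (X2 ^ d2 * q) m = 0" for m
    by (simp flip: lookup_add)
  have "p \<in> gen_ideal3 (X2 ^ d2) (X2 ^ d2) (X2 ^ d2)"
    unfolding X_power
  proof (rule gen_ideal3_monomialsI)
    fix m assume mk: "m \<in> keys p"
    obtain a b c where m: "m = (a, b, c)" by (cases m)
    have "d2 \<le> b"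
      using pq'[of "(a + d1, b, c)"] mk by (auto simp: lookup_X_power_times m in_keys_iff split: if_splits)
    then show "mdvd (0, d2, 0) m \<or> mdvd (0, d2, 0) m \<or> mdvd (0, d2, 0) m"
      by (simp add: mdvd_def m)
  qed
  then obtain u1 u2 u3 where u: "p = u1 * X2 ^ d2 + u2 * X2 ^ d2 + u3 * X2 ^ d2"
    unfolding gen_ideal3_def by blast
  define u where "u = u1 + u2 + u3"
  have p: "p = u * X2 ^ d2" unfolding u u_def by (simp add: algebra_simps)
  have "X2 ^ d2 * (q + u * X1 ^ d1) = 0" using pq unfolding p by (simp add: algebra_simps)
  then have "lookup (X2 ^ d2 * (q + u * X1 ^ d1)) (a, b + d2, c) = 0" for a b c by simp
  then have "lookup (q + u * X1 ^ d1) m = 0" for m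
    by (cases m) (simp add: lookup_X_power_times)
  then have "q + u * X1 ^ d1 = 0" by (intro poly_mapping_eqI) simp
  then have q: "q = - u * X1 ^ d1" by (simp add: eq_neg_iff_add_eq_0)
  show ?thesis
  proof (rule that)
    show "h1 = u * X2 ^ d2 + - v * X3 ^ d3" using p by (simp add: p_def algebra_simps)
    show "h2 = - u * X1 ^ d1 + - w * X3 ^ d3" using q by (simp add: q_def algebra_simps)
    show "h3 = - (- v) * X1 ^ d1 - (- w) * X2 ^ d2" by (simp add: h3 w_def algebra_simps)
  qed
qed

lemma strong_Lefschetz_injective_y:
  fixes g :: "'a::field_char_0 poly3"
  assumes "d1 + d2 + d3 = e + 3" "2 * i + k = e" "g \<in> Hom i 0"
    "(X1 + X2 + X3) ^ k * g \<in> gen_ideal3 (X1 ^ d1) (X2 ^ d2) (X3 ^ d3)"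
  shows "g \<in> gen_ideal3 (X1 ^ d1) (X2 ^ d2) (X3 ^ d3)"
proof -
  have "supported_in i (lookup g)" using HomD[OF assms(3)] by (fastforce simp: supported_in_def mdeg_def)
  then show ?thesis
    using strong_Lefschetz_injective[OF assms(1,2)] assms(4)
    by (simp add: gen_ideal3_X_power_iff lookup_linear_form_power_times)
qed

text \<open>The duality of the complete intersection: complementing every exponent in the box
  exchanges degrees i and e - i.\<close>

lemma card_box_degree_symmetric:
  fixes d1 d2 d3 :: nat
  assumes "d1 + d2 + d3 = e + 3" "i + j = e"
  shows "card {(a, b, c). a < d1 \<and> b < d2 \<and> c < d3 \<and> a + b + c = j} \<le>
    card {(a, b, c). a < d1 \<and> b < d2 \<and> c < d3 \<and> a + b + c = i}" (is "card ?A \<le> card ?B")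
proof (rule card_inj_on_le)
  let ?\<iota> = "\<lambda>(a, b, c). (d1 - 1 - a, d2 - 1 - b, d3 - 1 - c)"
  show "inj_on ?\<iota> ?A" by (auto simp: inj_on_def)
  show "?\<iota> ` ?A \<subseteq> ?B" using assms by auto
  show "finite ?B" by (rule finite_subset[of _ "{..<d1} \<times> {..<d2} \<times> {..<d3}"]) auto
qed

text \<open>By the symmetry of the box the target has no larger dimension than the source, so
  injectivity already gives surjectivity.\<close>

lemma strong_Lefschetz_surjective_y:
  fixes s :: "'a::field_char_0 poly3"
  assumes e: "d1 + d2 + d3 = e + 3" and k: "2 * i + k = e" and s: "s \<in> Hom (i + k) 0"
  obtains g where "g \<in> Hom i 0" "s - (X1 + X2 + X3) ^ k * g \<in> gen_ideal3 (X1 ^ d1) (X2 ^ d2) (X3 ^ d3)"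
proof -
  define N where "N j = {(a, b, c). a < d1 \<and> b < d2 \<and> c < d3 \<and> a + b + c = j}" for j
  define box where "box = {(a, b, c). a < d1 \<and> b < d2 \<and> c < d3}"
  \<comment> \<open>Cutting off outside the box represents the product in the quotient, as the
    monomials there lie in the ideal.\<close>
  define v :: "mono3 \<Rightarrow> mono3 \<Rightarrow> 'a" where
    "v m m' = (if m' \<in> box then lookup ((X1 + X2 + X3) ^ k * single m 1) m' else 0)" for m m'
  have fin: "finite (N j)" for j
    by (rule finite_subset[of _ "{..<d1} \<times> {..<d2} \<times> {..<d3}"]) (auto simp: N_def)
  have N: "m \<in> N j \<longleftrightarrow> m \<in> box \<and> mdeg m = j" for m j
    by (auto simp: N_def box_def mdeg_def)
  have L: "(X1 + X2 + X3) ^ k * single m (1 :: 'a) \<in> Hom (mdeg m + k) 0" for m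
    using Hom_mult[OF linear_form_power_Hom[of k "mdeg m"] Hom_single[of m 0 "mdeg m" 1]]
    by (simp add: add.commute)
  define G where "G \<alpha> = (\<Sum>m\<in>N i. single m (\<alpha> m :: 'a))" for \<alpha>
  have G: "G \<alpha> \<in> Hom i 0" for \<alpha> unfolding G_def by (intro Hom_sum Hom_single) (auto simp: N)
  have LG: "lookup ((X1 + X2 + X3) ^ k * G \<alpha>) m' = (\<Sum>m\<in>N i. \<alpha> m * v m m')" if "m' \<in> box" for \<alpha> m'
  proof -
    have "(X1 + X2 + X3) ^ k * single m (\<alpha> m) = single 0 (\<alpha> m) * ((X1 + X2 + X3) ^ k * single m 1)" for m
      by (simp add: mult_single mult.left_commute[of "single 0 (\<alpha> m)"])
    then show ?thesis
      using that by (simp add: G_def sum_distrib_left lookup_sum v_def)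
  qed
  have "indep (N i) v"
  proof (rule indepI)
    fix \<alpha> m
    assume z: "\<And>m'. (\<Sum>m\<in>N i. \<alpha> m * v m m') = 0" and m: "m \<in> N i"
    have "(X1 + X2 + X3) ^ k * G \<alpha> \<in> gen_ideal3 (X1 ^ d1) (X2 ^ d2) (X3 ^ d3)"
      unfolding gen_ideal3_X_power_iff vanishes_on_box_def by (auto simp: LG z box_def)
    then have "G \<alpha> \<in> gen_ideal3 (X1 ^ d1) (X2 ^ d2) (X3 ^ d3)"
      by (rule strong_Lefschetz_injective_y[OF e k G])
    then have "lookup (G \<alpha>) m = 0"
      using m unfolding gen_ideal3_X_power_iff vanishes_on_box_def by (auto simp: N_def)
    then show "\<alpha> m = 0"
      using m fin by (simp add: G_def lookup_sum lookup_single when_def)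
  qed
  moreover have "card (N (i + k)) \<le> card (N i)"
    unfolding N_def by (rule card_box_degree_symmetric[OF e]) (use k in simp)
  moreover have "v m m' = 0" if "m \<in> N i" "m' \<notin> N (i + k)" for m m'
    using that HomD[OF L, of m m'] by (auto simp: v_def N)
  moreover have "(if m' \<in> box then lookup s m' else 0) = 0" if "m' \<notin> N (i + k)" for m'
    using that HomD[OF s, of m'] by (auto simp: N)
  ultimately obtain \<alpha> where \<alpha>: "\<And>m'. (if m' \<in> box then lookup s m' else 0) = (\<Sum>m\<in>N i. \<alpha> m * v m m')"
    using indep_span[OF fin fin, of i v "i + k" "\<lambda>m'. if m' \<in> box then lookup s m' else 0"] by blast
  have "lookup (s - (X1 + X2 + X3) ^ k * G \<alpha>) m = 0" if "m \<in> box" for m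
    using \<alpha>[of m] that by (simp add: lookup_minus LG)
  then have "s - (X1 + X2 + X3) ^ k * G \<alpha> \<in> gen_ideal3 (X1 ^ d1) (X2 ^ d2) (X3 ^ d3)"
    unfolding gen_ideal3_X_power_iff vanishes_on_box_def by (simp add: box_def)
  with G show ?thesis by (rule that)
qed

section \<open>Substitutions\<close>

definition eval3 :: "('a::comm_ring_1 \<Rightarrow> 'r::comm_ring_1) \<Rightarrow> 'r \<Rightarrow> 'r \<Rightarrow> 'r \<Rightarrow> 'a poly3 \<Rightarrow> 'r" where
  "eval3 c p1 p2 p3 f = (\<Sum>m\<in>keys f. c (lookup f m) * (case m of (i, j, k) \<Rightarrow> p1 ^ i * p2 ^ j * p3 ^ k))"

locale eval3_hom =
  fixes c :: "'a::comm_ring_1 \<Rightarrow> 'r::comm_ring_1" and p1 p2 p3 :: 'r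
  assumes c_hom: "c (a + b) = c a + c b" "c (a * b) = c a * c b" "c 1 = 1"
begin

sublocale evaluation c "\<lambda>(i, j, k). p1 ^ i * p2 ^ j * p3 ^ k"
  rewrites "ev = eval3 c p1 p2 p3"
proof -
  show e: "evaluation c (\<lambda>(i, j, k). p1 ^ i * p2 ^ j * p3 ^ k)"
    by unfold_locales (auto simp: c_hom power_add zero_prod_def mult_ac)
  show "evaluation.ev c (\<lambda>(i, j, k). p1 ^ i * p2 ^ j * p3 ^ k) = eval3 c p1 p2 p3"
    by (rule ext) (simp add: evaluation.ev_def[OF e] eval3_def)
qed

lemma ev_const: "eval3 c p1 p2 p3 (single 0 a) = c a"
  by (simp add: ev_single w_zero[simplified zero_prod_def] zero_prod_def)

lemma ev_X: "eval3 c p1 p2 p3 X1 = p1" "eval3 c p1 p2 p3 X2 = p2" "eval3 c p1 p2 p3 X3 = p3"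
  by (simp_all add: X1_def X2_def X3_def ev_single c_hom)

end

definition subst :: "'a::comm_ring_1 poly3 \<Rightarrow> 'a poly3 \<Rightarrow> 'a poly3 \<Rightarrow> 'a poly3 \<Rightarrow> 'a poly3" where
  "subst = eval3 (single 0)"

interpretation subst: eval3_hom "single 0 :: 'a::comm_ring_1 \<Rightarrow> 'a poly3" p1 p2 p3
  rewrites "eval3 (single 0) p1 p2 p3 = subst p1 p2 p3"
  for p1 p2 p3
  by unfold_locales (simp_all add: single_add mult_single subst_def)

lemma single_eq_X_powers: "single (i, j, k) c = single 0 c * (X1 ^ i * X2 ^ j * X3 ^ k)"
  by (simp add: X_power mult_single zero_prod_def)

lemma subst_eq_id:
  assumes "subst p1 p2 p3 q1 = X1" "subst p1 p2 p3 q2 = X2" "subst p1 p2 p3 q3 = X3"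
  shows "subst p1 p2 p3 (subst q1 q2 q3 f) = f"
proof (induction f rule: poly_mapping_induct)
  case (single m c)
  obtain i j k where m: "m = (i, j, k)" by (cases m)
  show ?case
    unfolding m single_eq_X_powers
    by (simp add: subst.ev_mult subst.ev_power subst.ev_const subst.ev_X assms)
qed (simp_all add: subst.ev_zero subst.ev_add)

lemma subst_Hom:
  assumes p: "p1 \<in> Hom 1 0" "p2 \<in> Hom 1 0" "p3 \<in> Hom 1 0" and f: "f \<in> Hom n d"
  shows "subst p1 p2 p3 f \<in> Hom n d"
proof -
  have "subst p1 p2 p3 f = (\<Sum>m\<in>keys f. single 0 (lookup f m) * (case m of (i, j, k) \<Rightarrow> p1 ^ i * p2 ^ j * p3 ^ k))"
    by (simp add: subst_def eval3_def)
  also have "\<dots> \<in> Hom n d"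
  proof (intro Hom_sum Hom_const_times)
    fix m assume "m \<in> keys f"
    moreover obtain i j k where m: "m = (i, j, k)" by (cases m)
    ultimately have n: "n = i + j + k + d" using HomD[OF f, of m] by (simp add: in_keys_iff mdeg_def)
    have "p1 ^ i \<in> Hom (i + (j + k + d)) (j + k + d)" "p2 ^ j \<in> Hom (j + (k + d)) (k + d)"
      "p3 ^ k \<in> Hom (k + d) d"
      using p by (intro Hom_power; simp)+
    then have "p1 ^ i * p2 ^ j * p3 ^ k \<in> Hom n d"
      unfolding n by (intro Hom_mult[of _ _ "k + d"] Hom_mult[of _ _ "j + k + d"]) (auto simp: add.assoc)
    then show "(case m of (i, j, k) \<Rightarrow> p1 ^ i * p2 ^ j * p3 ^ k) \<in> Hom n d" by (simp add: m)
  qed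
  finally show ?thesis .
qed

lemma subst_gen_ideal3:
  assumes "g \<in> gen_ideal3 f1 f2 f3"
  shows "subst p1 p2 p3 g \<in> gen_ideal3 (subst p1 p2 p3 f1) (subst p1 p2 p3 f2) (subst p1 p2 p3 f3)"
proof -
  obtain h1 h2 h3 where g: "g = h1 * f1 + h2 * f2 + h3 * f3"
    using assms unfolding gen_ideal3_def by blast
  then have "subst p1 p2 p3 g = subst p1 p2 p3 h1 * subst p1 p2 p3 f1 + subst p1 p2 p3 h2 * subst p1 p2 p3 f2
      + subst p1 p2 p3 h3 * subst p1 p2 p3 f3"
    by (simp add: subst.ev_add subst.ev_mult)
  then show ?thesis unfolding gen_ideal3_def by blast
qed

section \<open>The complete intersection \<open>x1^d1, x2^d2, (x3 - x1 - x2)^d3\<close>\<close>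

text \<open>The reverse lexicographic order singles out x3, while the sl2 argument is about the sum
  of the variables. This change of coordinates turns the sum into x3, and \<open>\<tau>\<close>
  undoes it.\<close>

abbreviation \<sigma> :: "'a::comm_ring_1 poly3 \<Rightarrow> 'a poly3" where "\<sigma> \<equiv> subst X1 X2 (X3 - X1 - X2)"
abbreviation \<tau> :: "'a::comm_ring_1 poly3 \<Rightarrow> 'a poly3" where "\<tau> \<equiv> subst X1 X2 (X1 + X2 + X3)"

lemma \<sigma>_\<tau>: "\<sigma> (\<tau> f) = f"
  by (rule subst_eq_id) (simp_all add: subst.ev_X subst.ev_add)

lemma \<sigma>_Hom: "f \<in> Hom n d \<Longrightarrow> \<sigma> f \<in> Hom n d"
  by (intro subst_Hom Hom_diff X_Hom)

lemma \<tau>_Hom: "f \<in> Hom n d \<Longrightarrow> \<tau> f \<in> Hom n d"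
  by (intro subst_Hom Hom_add X_Hom)

lemma \<sigma>_linear_form: "\<sigma> (X1 + X2 + X3) = X3"
  by (simp add: subst.ev_X subst.ev_add)

lemma \<tau>_X3: "\<tau> X3 = X1 + X2 + X3"
  by (simp add: subst.ev_X)

context
  fixes d1 d2 d3 e :: nat and f1 f2 f3 :: "'a::field_char_0 poly3"
  assumes e: "d1 + d2 + d3 = e + 3"
  defines "f1 \<equiv> X1 ^ d1" and "f2 \<equiv> X2 ^ d2" and "f3 \<equiv> (X3 - X1 - X2) ^ d3"
begin

lemma special_generators:
  "\<sigma> (X1 ^ d1) = f1" "\<sigma> (X2 ^ d2) = f2" "\<sigma> (X3 ^ d3) = f3"
  "\<tau> f1 = X1 ^ d1" "\<tau> f2 = X2 ^ d2" "\<tau> f3 = X3 ^ d3"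
  by (simp_all add: f1_def f2_def f3_def subst.ev_power subst.ev_X subst.ev_diff)

lemma special_in_hspace: "(f1, f2, f3) \<in> hspace d1 d2 d3"
  using Hom_power[of "X3 - X1 - X2 :: 'a poly3" d3 0]
  by (simp add: hspace_def homogeneous_iff_Hom f1_def f2_def f3_def X_power_Hom Hom_diff X_Hom[simplified])

lemma \<sigma>_special: "g \<in> gen_ideal3 (X1 ^ d1) (X2 ^ d2) (X3 ^ d3) \<Longrightarrow> \<sigma> g \<in> gen_ideal3 f1 f2 f3"
  using subst_gen_ideal3[of g "X1 ^ d1" "X2 ^ d2" "X3 ^ d3" X1 X2 "X3 - X1 - X2"]
  by (simp add: special_generators)

lemma \<tau>_special: "g \<in> gen_ideal3 f1 f2 f3 \<Longrightarrow> \<tau> g \<in> gen_ideal3 (X1 ^ d1) (X2 ^ d2) (X3 ^ d3)"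
  using subst_gen_ideal3[of g f1 f2 f3 X1 X2 "X1 + X2 + X3"]
  by (simp add: special_generators)

lemma special_surjective:
  assumes "2 * i + k = e" "s \<in> Hom (i + k) 0"
  obtains g where "g \<in> Hom i 0" "s - X3 ^ k * g \<in> gen_ideal3 f1 f2 f3"
proof -
  obtain g where g: "g \<in> Hom i 0"
    "\<tau> s - (X1 + X2 + X3) ^ k * g \<in> gen_ideal3 (X1 ^ d1) (X2 ^ d2) (X3 ^ d3)"
    by (rule strong_Lefschetz_surjective_y[OF e assms(1) \<tau>_Hom[OF assms(2)]])
  have "\<sigma> (\<tau> s - (X1 + X2 + X3) ^ k * g) = s - X3 ^ k * \<sigma> g"
    by (simp add: subst.ev_diff subst.ev_mult subst.ev_power \<sigma>_linear_form \<sigma>_\<tau> del: subst.ev_add)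
  with \<sigma>_special[OF g(2)] have "s - X3 ^ k * \<sigma> g \<in> gen_ideal3 f1 f2 f3" by simp
  then show ?thesis by (rule that[OF \<sigma>_Hom[OF g(1)]])
qed

lemma special_injective:
  assumes "2 * i + k = e" "g \<in> Hom i 0" "X3 ^ k * g \<in> gen_ideal3 f1 f2 f3"
  shows "g \<in> gen_ideal3 f1 f2 f3"
proof -
  have "\<tau> g \<in> gen_ideal3 (X1 ^ d1) (X2 ^ d2) (X3 ^ d3)"
    using \<tau>_special[OF assms(3)]
    by (intro strong_Lefschetz_injective_y[OF e assms(1) \<tau>_Hom[OF assms(2)]])
      (simp only: subst.ev_mult subst.ev_power \<tau>_X3)
  from \<sigma>_special[OF this] show ?thesis by (simp add: \<sigma>_\<tau>)
qed

lemma special_high_degree: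
  assumes "e < n" "s \<in> Hom n 0"
  shows "s \<in> gen_ideal3 f1 f2 f3"
  using \<sigma>_special[OF high_degree_in_ideal_y[OF e assms(1) \<tau>_Hom[OF assms(2)]]] by (simp add: \<sigma>_\<tau>)

lemma special_koszul:
  assumes "h1 * f1 + h2 * f2 + h3 * f3 = 0"
  obtains u v w where "h1 = u * f2 + v * f3" "h2 = - u * f1 + w * f3" "h3 = - v * f1 - w * f2"
proof -
  have "\<tau> (h1 * f1 + h2 * f2 + h3 * f3) = 0" unfolding assms by (rule subst.ev_zero)
  then have "\<tau> h1 * X1 ^ d1 + \<tau> h2 * X2 ^ d2 + \<tau> h3 * X3 ^ d3 = 0"
    by (simp add: subst.ev_mult subst.ev_add special_generators)
  then obtain u v w where "\<tau> h1 = u * X2 ^ d2 + v * X3 ^ d3" "\<tau> h2 = - u * X1 ^ d1 + w * X3 ^ d3"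
    "\<tau> h3 = - v * X1 ^ d1 - w * X2 ^ d2"
    by (rule koszul_y)
  then have "\<sigma> (\<tau> h1) = \<sigma> (u * X2 ^ d2 + v * X3 ^ d3)" "\<sigma> (\<tau> h2) = \<sigma> (- u * X1 ^ d1 + w * X3 ^ d3)"
    "\<sigma> (\<tau> h3) = \<sigma> (- v * X1 ^ d1 - w * X2 ^ d2)"
    by simp_all
  then have "h1 = \<sigma> u * f2 + \<sigma> v * f3" "h2 = - \<sigma> u * f1 + \<sigma> w * f3" "h3 = - \<sigma> v * f1 - \<sigma> w * f2"
    unfolding \<sigma>_\<tau>
    by (simp_all only: subst.ev_mult subst.ev_add subst.ev_diff subst.ev_uminus special_generators)
  then show ?thesis by (rule that)
qed

end

section \<open>Multiplication by powers of \<open>x3\<close> modulo a generic ideal\<close>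

lemma Hom_regrade: "f \<in> Hom n d \<Longrightarrow> n' + d = n + d' \<Longrightarrow> f \<in> Hom n' d'"
  unfolding Hom_def by auto

lemma Hom_multI:
  fixes f :: "'a::comm_ring_1 poly3"
  assumes "h \<in> Hom n d" "f \<in> Hom l l'" "n + l + d' = n' + d + l'"
  shows "h * f \<in> Hom n' d'"
proof -
  have "f \<in> Hom (d + l) (d + l')" by (rule Hom_regrade[OF assms(2)]) simp
  then have "h * f \<in> Hom (n + l) (d + l')"
    using Hom_regrade[OF assms(1), of "n + l" "d + l"] by (intro Hom_mult[of _ _ "d + l"]) simp_all
  then show ?thesis by (rule Hom_regrade) (use assms(3) in simp)
qed

text \<open>Projection to one degree makes the multipliers homogeneous, so that they range over a
  finite-dimensional space.\<close>

lemma gen_ideal3_Hom: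
  fixes s :: "'a::comm_ring_1 poly3"
  assumes "s \<in> gen_ideal3 f1 f2 f3" "s \<in> Hom n d" "f1 \<in> Hom d1 0" "f2 \<in> Hom d2 0" "f3 \<in> Hom d3 0"
  obtains h1 h2 h3 where "h1 \<in> Hom n (d + d1)" "h2 \<in> Hom n (d + d2)" "h3 \<in> Hom n (d + d3)"
    "s = h1 * f1 + h2 * f2 + h3 * f3"
proof -
  obtain h1 h2 h3 where s: "s = h1 * f1 + h2 * f2 + h3 * f3"
    using assms(1) unfolding gen_ideal3_def by blast
  have f: "f1 \<in> Hom (d + d1) d" "f2 \<in> Hom (d + d2) d" "f3 \<in> Hom (d + d3) d"
    by (rule Hom_regrade[OF assms(3)] Hom_regrade[OF assms(4)] Hom_regrade[OF assms(5)]; simp)+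
  have "s = hcomp n d s" using assms(2) by (simp add: hcomp_Hom)
  also have "\<dots> = hcomp n (d + d1) h1 * f1 + hcomp n (d + d2) h2 * f2 + hcomp n (d + d3) h3 * f3"
    unfolding s by (simp add: hcomp_add hcomp_mult[OF f(1)] hcomp_mult[OF f(2)] hcomp_mult[OF f(3)])
  finally show ?thesis by (intro that[of "hcomp n (d + d1) h1" "hcomp n (d + d2) h2" "hcomp n (d + d3) h3"] hcomp_in_Hom)
qed

text \<open>A preimage of \<open>s\<close> represents \<open>s\<close> as a multiple of X3^k modulo
  the ideal, and a kernel element exhibits a multiple of X3^k inside the ideal; surjectivity and
  injectivity are read off the same map.\<close>

definition relation_map :: "nat \<Rightarrow> 'a::comm_ring_1 poly3 \<times> 'a poly3 \<times> 'a poly3 \<Rightarrow> (nat \<Rightarrow> 'a poly3) \<Rightarrow> 'a poly3" where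
  "relation_map k f q = X3 ^ k * q 0 - (q 1 * fst f + q 2 * fst (snd f) + q 3 * snd (snd f))"

text \<open>The Koszul relations: \<open>p 0\<close>, \<open>p 1\<close>, \<open>p 2\<close> pair
  X3^k with the generators, and \<open>p 3\<close>, \<open>p 4\<close>, \<open>p 5\<close> belong to
  the pairs (1,2), (1,3), (2,3) of generators. The zeroth entry always lies in the ideal, which is
  what injectivity asks for.\<close>

definition trivial_relation ::
  "nat \<Rightarrow> 'a::comm_ring_1 poly3 \<times> 'a poly3 \<times> 'a poly3 \<Rightarrow> (nat \<Rightarrow> 'a poly3) \<Rightarrow> nat \<Rightarrow> 'a poly3" where
  "trivial_relation k f p n =
    (if n = 0 then p 0 * fst f + p 1 * fst (snd f) + p 2 * snd (snd f)
     else if n = 1 then X3 ^ k * p 0 + p 3 * fst (snd f) + p 4 * snd (snd f)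
     else if n = 2 then X3 ^ k * p 1 - p 3 * fst f + p 5 * snd (snd f)
     else if n = 3 then X3 ^ k * p 2 - p 4 * fst f - p 5 * fst (snd f)
     else 0)"

lemma relation_map_trivial [simp]: "relation_map k f (trivial_relation k f p) = 0"
  by (simp add: relation_map_def trivial_relation_def algebra_simps)

definition lincomb :: "'k set \<Rightarrow> ('k \<Rightarrow> 'a::comm_ring_1) \<Rightarrow> ('k \<Rightarrow> nat \<Rightarrow> 'a poly3) \<Rightarrow> nat \<Rightarrow> 'a poly3" where
  "lincomb K \<alpha> q n = (\<Sum>k\<in>K. single 0 (\<alpha> k) * q k n)"

lemma lookup_lincomb: "lookup (lincomb K \<alpha> q n) m = (\<Sum>k\<in>K. \<alpha> k * lookup (q k n) m)"
  by (simp add: lincomb_def lookup_sum)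

lemma relation_map_lincomb:
  "relation_map l f (lincomb K \<alpha> q) = (\<Sum>k\<in>K. single 0 (\<alpha> k) * relation_map l f (q k))"
  by (simp add: relation_map_def lincomb_def sum_distrib_left sum_distrib_right sum.distrib sum_subtractf
      right_diff_distrib distrib_left mult_ac)

lemma lookup_relation_map_lincomb:
  "lookup (relation_map l f (lincomb K \<alpha> q)) m = (\<Sum>k\<in>K. \<alpha> k * lookup (relation_map l f (q k)) m)"
  by (simp add: relation_map_lincomb lookup_sum)

text \<open>The maps \<open>trivial_relation\<close> and \<open>relation_map\<close> form a complex
  \<open>A_space \<rightarrow> B_space \<rightarrow> S_(j - \<delta>)\<close>, and its exactness at the middle and right terms is an open
  condition on \<open>f\<close>. For \<open>i = 0\<close> and \<open>\<delta> = 1\<close> the space \<open>Hom i \<delta>\<close> is zero, and surjectivity says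
  that all forms of degree \<open>k - 1\<close> lie in the ideal.\<close>

context
  fixes d1 d2 d3 i \<delta> k j :: nat
  assumes j: "j = i + k"
begin

definition A_space :: "(nat \<Rightarrow> 'a::comm_ring_1 poly3) set" where
  "A_space = {p. p 0 \<in> Hom i (\<delta> + d1) \<and> p 1 \<in> Hom i (\<delta> + d2) \<and> p 2 \<in> Hom i (\<delta> + d3) \<and>
     p 3 \<in> Hom j (\<delta> + d1 + d2) \<and> p 4 \<in> Hom j (\<delta> + d1 + d3) \<and> p 5 \<in> Hom j (\<delta> + d2 + d3)}"

definition B_space :: "(nat \<Rightarrow> 'a::comm_ring_1 poly3) set" where
  "B_space = {q. q 0 \<in> Hom i \<delta> \<and> q 1 \<in> Hom j (\<delta> + d1) \<and> q 2 \<in> Hom j (\<delta> + d2) \<and> q 3 \<in> Hom j (\<delta> + d3) \<and>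
     (\<forall>n>3. q n = 0)}"

definition B_index :: "(nat \<times> mono3) set" where
  "B_index = {0} \<times> {m. mdeg m + \<delta> = i} \<union> {1} \<times> {m. mdeg m + (\<delta> + d1) = j} \<union>
     {2} \<times> {m. mdeg m + (\<delta> + d2) = j} \<union> {3} \<times> {m. mdeg m + (\<delta> + d3) = j}"

lemma finite_B_index: "finite B_index"
  unfolding B_index_def by (intro finite_UnI finite_cartesian_product finite_mdeg_eq) auto

lemma B_space_index:
  assumes q: "q \<in> B_space" and b: "(n, m) \<notin> B_index"
  shows "lookup (q n) m = 0"
proof (rule ccontr)
  assume nz: "lookup (q n) m \<noteq> 0"
  have "n \<le> 3"
  proof (rule ccontr)
    assume "\<not> n \<le> 3"
    then have "q n = 0" using q by (simp add: B_space_def)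
    then show False using nz by simp
  qed
  then consider "n = 0" | "n = 1" | "n = 2" | "n = 3" by linarith
  then have "(n, m) \<in> B_index"
    using q nz by cases (auto simp: B_space_def B_index_def dest: HomD)
  with b show False by blast
qed

lemma B_space_unit:
  assumes "(n, m) \<in> B_index"
  shows "(\<lambda>n'. if n' = n then single m 1 else 0) \<in> (B_space :: (nat \<Rightarrow> 'a::comm_ring_1 poly3) set)"
  using assms unfolding B_index_def B_space_def by (auto intro: Hom_single)

lemma B_space_lincomb:
  assumes "\<And>k. k \<in> K \<Longrightarrow> q k \<in> B_space"
  shows "lincomb K \<alpha> q \<in> B_space"
  using assms unfolding B_space_def lincomb_def
  by (auto intro!: Hom_sum Hom_const_times)

lemma B_space_diff:
  fixes q :: "nat \<Rightarrow> 'a::comm_ring_1 poly3"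
  shows "q \<in> B_space \<Longrightarrow> r \<in> B_space \<Longrightarrow> (\<lambda>n. q n - r n) \<in> B_space"
  unfolding B_space_def by (auto intro: Hom_diff)

lemma relation_map_Hom:
  fixes q :: "nat \<Rightarrow> 'a::comm_ring_1 poly3"
  assumes f: "f \<in> hspace d1 d2 d3" and q: "q \<in> B_space"
  shows "relation_map k f q \<in> Hom j \<delta>"
proof -
  have "fst f \<in> Hom d1 0" "fst (snd f) \<in> Hom d2 0" "snd (snd f) \<in> Hom d3 0"
    using f by (auto simp: hspace_def homogeneous_iff_Hom)
  then have "q 1 * fst f \<in> Hom j \<delta>" "q 2 * fst (snd f) \<in> Hom j \<delta>" "q 3 * snd (snd f) \<in> Hom j \<delta>"
    using q by (auto simp: B_space_def intro: Hom_multI)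
  moreover have "X3 ^ k * q 0 \<in> Hom j \<delta>"
  proof (rule Hom_multI[OF X_power_Hom(3)])
    show "q 0 \<in> Hom i \<delta>" using q by (simp add: B_space_def)
  qed (simp add: j)
  ultimately show ?thesis
    unfolding relation_map_def by (intro Hom_diff Hom_add)
qed

lemma trivial_relation_in_B_space:
  fixes p :: "nat \<Rightarrow> 'a::comm_ring_1 poly3"
  assumes f: "f \<in> hspace d1 d2 d3" and p: "p \<in> A_space"
  shows "trivial_relation k f p \<in> B_space"
proof -
  have f': "fst f \<in> Hom d1 0" "fst (snd f) \<in> Hom d2 0" "snd (snd f) \<in> Hom d3 0"
    using f by (auto simp: hspace_def homogeneous_iff_Hom)
  have p': "p 0 \<in> Hom i (\<delta> + d1)" "p 1 \<in> Hom i (\<delta> + d2)" "p 2 \<in> Hom i (\<delta> + d3)"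
     "p 3 \<in> Hom j (\<delta> + d1 + d2)" "p 4 \<in> Hom j (\<delta> + d1 + d3)" "p 5 \<in> Hom j (\<delta> + d2 + d3)"
    using p unfolding A_space_def by blast+
  have "trivial_relation k f p 0 \<in> Hom i \<delta>"
    unfolding trivial_relation_def using Hom_multI[OF p'(1) f'(1)] Hom_multI[OF p'(2) f'(2)] Hom_multI[OF p'(3) f'(3)]
    by (simp add: Hom_add)
  moreover have "trivial_relation k f p 1 \<in> Hom j (\<delta> + d1)"
    unfolding trivial_relation_def
    using Hom_multI[OF X_power_Hom(3) p'(1)] Hom_multI[OF p'(4) f'(2)] Hom_multI[OF p'(5) f'(3)]
    by (simp add: Hom_add j)
  moreover have "trivial_relation k f p 2 \<in> Hom j (\<delta> + d2)"
    unfolding trivial_relation_def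
    using Hom_multI[OF X_power_Hom(3) p'(2)] Hom_multI[OF p'(4) f'(1)] Hom_multI[OF p'(6) f'(3)]
    by (simp add: Hom_add Hom_diff j)
  moreover have "trivial_relation k f p 3 \<in> Hom j (\<delta> + d3)"
    unfolding trivial_relation_def
    using Hom_multI[OF X_power_Hom(3) p'(3)] Hom_multI[OF p'(5) f'(1)] Hom_multI[OF p'(6) f'(2)]
    by (simp add: Hom_add Hom_diff j)
  ultimately show ?thesis unfolding B_space_def by (simp add: trivial_relation_def)
qed

abbreviation ideal_of :: "'a::comm_ring_1 poly3 \<times> 'a poly3 \<times> 'a poly3 \<Rightarrow> 'a poly3 set" where
  "ideal_of f \<equiv> gen_ideal3 (fst f) (fst (snd f)) (snd (snd f))"

definition multiplication_bijective :: "'a::comm_ring_1 poly3 \<times> 'a poly3 \<times> 'a poly3 \<Rightarrow> bool" where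
  "multiplication_bijective f \<longleftrightarrow>
     (\<forall>s\<in>Hom j \<delta>. \<exists>g\<in>Hom i \<delta>. s - X3 ^ k * g \<in> ideal_of f) \<and>
     (\<forall>g\<in>Hom i \<delta>. X3 ^ k * g \<in> ideal_of f \<longrightarrow> g \<in> ideal_of f)"

lemma relation_surjective:
  fixes f :: "'a::comm_ring_1 poly3 \<times> 'a poly3 \<times> 'a poly3"
  assumes f: "f \<in> hspace d1 d2 d3" and s: "s \<in> Hom j \<delta>" and g: "g \<in> Hom i \<delta>" "s - X3 ^ k * g \<in> ideal_of f"
  obtains q where "q \<in> B_space" "relation_map k f q = s" "q 0 = g"
proof -
  have f': "fst f \<in> Hom d1 0" "fst (snd f) \<in> Hom d2 0" "snd (snd f) \<in> Hom d3 0"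
    using f by (auto simp: hspace_def homogeneous_iff_Hom)
  have "s - X3 ^ k * g \<in> Hom j \<delta>"
    using s Hom_multI[OF X_power_Hom(3) g(1)] by (simp add: Hom_diff j)
  then obtain h1 h2 h3 where h: "h1 \<in> Hom j (\<delta> + d1)" "h2 \<in> Hom j (\<delta> + d2)" "h3 \<in> Hom j (\<delta> + d3)"
    "s - X3 ^ k * g = h1 * fst f + h2 * fst (snd f) + h3 * snd (snd f)"
    by (rule gen_ideal3_Hom[OF g(2) _ f'])
  let ?q = "\<lambda>n :: nat. if n = 0 then g else if n = 1 then - h1 else if n = 2 then - h2 else if n = 3 then - h3 else 0"
  show ?thesis
  proof (rule that)
    show "?q \<in> B_space" using g h(1-3) by (auto simp: B_space_def intro: Hom_uminus)
    show "relation_map k f ?q = s" using h(4) by (simp add: relation_map_def algebra_simps)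
  qed simp
qed

text \<open>Injectivity puts \<open>q 0\<close> into the ideal. Subtracting the Koszul relations
  with its multipliers leaves a relation among the generators alone, to which \<open>koszul\<close>
  applies; components of the right degree then replace \<open>u\<close>, \<open>v\<close>,
  \<open>w\<close>.\<close>

lemma relation_exact:
  fixes f :: "'a::comm_ring_1 poly3 \<times> 'a poly3 \<times> 'a poly3"
  assumes f: "f \<in> hspace d1 d2 d3"
    and inj: "\<And>g. g \<in> Hom i \<delta> \<Longrightarrow> X3 ^ k * g \<in> ideal_of f \<Longrightarrow> g \<in> ideal_of f"
    and koszul: "\<And>h1 h2 h3. h1 * fst f + h2 * fst (snd f) + h3 * snd (snd f) = 0 \<Longrightarrow>
      \<exists>u v w. h1 = u * fst (snd f) + v * snd (snd f) \<and> h2 = - u * fst f + w * snd (snd f) \<and>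
        h3 = - v * fst f - w * fst (snd f)"
    and q: "q \<in> B_space" "relation_map k f q = 0"
  obtains p where "p \<in> A_space" "q = trivial_relation k f p"
proof -
  let ?f1 = "fst f" and ?f2 = "fst (snd f)" and ?f3 = "snd (snd f)"
  have f': "?f1 \<in> Hom d1 0" "?f2 \<in> Hom d2 0" "?f3 \<in> Hom d3 0"
    using f by (auto simp: hspace_def homogeneous_iff_Hom)
  have q': "q 0 \<in> Hom i \<delta>" "q 1 \<in> Hom j (\<delta> + d1)" "q 2 \<in> Hom j (\<delta> + d2)" "q 3 \<in> Hom j (\<delta> + d3)"
    "\<And>n. n > 3 \<Longrightarrow> q n = 0"
    using q(1) unfolding B_space_def by blast+
  have X: "X3 ^ k * q 0 = q 1 * ?f1 + q 2 * ?f2 + q 3 * ?f3"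
    using q(2) by (simp add: relation_map_def)
  have "q 0 \<in> ideal_of f"
    by (rule inj[OF q'(1)]) (unfold X gen_ideal3_def, blast)
  then obtain p0 p1 p2 where p: "p0 \<in> Hom i (\<delta> + d1)" "p1 \<in> Hom i (\<delta> + d2)" "p2 \<in> Hom i (\<delta> + d3)"
    "q 0 = p0 * ?f1 + p1 * ?f2 + p2 * ?f3"
    by (rule gen_ideal3_Hom[OF _ q'(1) f'])
  have "(q 1 - X3 ^ k * p0) * ?f1 + (q 2 - X3 ^ k * p1) * ?f2 + (q 3 - X3 ^ k * p2) * ?f3 = 0"
    using X unfolding p(4) by (simp add: algebra_simps)
  from koszul[OF this] obtain u v w where uvw: "q 1 - X3 ^ k * p0 = u * ?f2 + v * ?f3"
    "q 2 - X3 ^ k * p1 = - u * ?f1 + w * ?f3" "q 3 - X3 ^ k * p2 = - v * ?f1 - w * ?f2"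
    by blast
  define u' where "u' = hcomp j (\<delta> + d1 + d2) u"
  define v' where "v' = hcomp j (\<delta> + d1 + d3) v"
  define w' where "w' = hcomp j (\<delta> + d2 + d3) w"
  have Xp: "X3 ^ k * p0 \<in> Hom j (\<delta> + d1)" "X3 ^ k * p1 \<in> Hom j (\<delta> + d2)" "X3 ^ k * p2 \<in> Hom j (\<delta> + d3)"
    by (auto intro!: Hom_multI[OF X_power_Hom(3)] p simp: j)
  have hc: "hcomp j d (h * g) = hcomp j (d + l) h * g" if "g \<in> Hom l 0" for d l and h g :: "'a poly3"
    using hcomp_mult[OF Hom_regrade[OF that, of "d + l" d], of j h] by simp
  have "q 1 - X3 ^ k * p0 = hcomp j (\<delta> + d1) (q 1 - X3 ^ k * p0)"
    using q'(2) Xp(1) by (simp add: hcomp_Hom Hom_diff)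
  also have "\<dots> = u' * ?f2 + v' * ?f3"
    unfolding uvw u'_def v'_def by (simp add: hcomp_add hc[OF f'(2)] hc[OF f'(3)])
  finally have 1: "q 1 = X3 ^ k * p0 + u' * ?f2 + v' * ?f3" by (simp add: algebra_simps)
  have hneg: "hcomp j d (- h) = - hcomp j d h" for d and h :: "'a poly3"
    by (rule poly_mapping_eqI) (simp add: lookup_hcomp)
  have "q 2 - X3 ^ k * p1 = hcomp j (\<delta> + d2) (q 2 - X3 ^ k * p1)"
    using q'(3) Xp(2) by (simp add: hcomp_Hom Hom_diff)
  also have "\<dots> = - (u' * ?f1) + w' * ?f3"
    unfolding uvw u'_def w'_def by (simp add: hcomp_add hcomp_diff hneg hc[OF f'(1)] hc[OF f'(3)] add_ac)
  finally have 2: "q 2 = X3 ^ k * p1 - u' * ?f1 + w' * ?f3" by (simp add: algebra_simps)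
  have "q 3 - X3 ^ k * p2 = hcomp j (\<delta> + d3) (q 3 - X3 ^ k * p2)"
    using q'(4) Xp(3) by (simp add: hcomp_Hom Hom_diff)
  also have "\<dots> = - (v' * ?f1) - w' * ?f2"
    unfolding uvw v'_def w'_def by (simp add: hcomp_diff hneg hc[OF f'(1)] hc[OF f'(2)] add_ac)
  finally have 3: "q 3 = X3 ^ k * p2 - v' * ?f1 - w' * ?f2" by (simp add: algebra_simps)
  let ?p = "\<lambda>n :: nat. if n = 0 then p0 else if n = 1 then p1 else if n = 2 then p2
    else if n = 3 then u' else if n = 4 then v' else w'"
  show ?thesis
  proof (rule that)
    show "?p \<in> A_space" using p by (simp add: A_space_def u'_def v'_def w'_def hcomp_in_Hom)
    show "q = trivial_relation k f ?p"
    proof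
      fix n :: nat
      consider "n = 0" | "n = 1" | "n = 2" | "n = 3" | "n > 3" by linarith
      then show "q n = trivial_relation k f ?p n"
        by cases (use 1 2 3 p(4) q'(5) in \<open>simp_all add: trivial_relation_def\<close>)
    qed
  qed
qed

text \<open>At \<open>f0\<close> the preimages \<open>qs\<close> of the monomials together with a
  basis of the trivial relations form a basis of \<open>B_space\<close>. The \<open>qs\<close> stay
  fixed and the trivial relations move with \<open>f\<close>; independence persists on an open set
  and, as the size of the family is right, so does spanning. A relation for such an \<open>f\<close>
  is a combination from which independence of the images removes the \<open>qs\<close>, so its
  zeroth entry lies in the ideal.\<close>

theorem generic_multiplication_bijective:
  fixes f0 :: "'a::field_char_0 poly3 \<times> 'a poly3 \<times> 'a poly3"
  assumes f0: "f0 \<in> hspace d1 d2 d3"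
    and surj: "\<And>s. s \<in> Hom j \<delta> \<Longrightarrow> \<exists>g\<in>Hom i \<delta>. s - X3 ^ k * g \<in> ideal_of f0"
    and inj: "\<And>g. g \<in> Hom i \<delta> \<Longrightarrow> X3 ^ k * g \<in> ideal_of f0 \<Longrightarrow> g \<in> ideal_of f0"
    and koszul: "\<And>h1 h2 h3. h1 * fst f0 + h2 * fst (snd f0) + h3 * snd (snd f0) = 0 \<Longrightarrow>
      \<exists>u v w. h1 = u * fst (snd f0) + v * snd (snd f0) \<and> h2 = - u * fst f0 + w * snd (snd f0) \<and>
        h3 = - v * fst f0 - w * fst (snd f0)"
  shows "principal_generic d1 d2 d3 (multiplication_bijective :: 'a poly3 \<times> 'a poly3 \<times> 'a poly3 \<Rightarrow> bool)"
proof -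
  define M where "M = {m. mdeg m + \<delta> = j}"
  have finM: "finite M" unfolding M_def by (rule finite_mdeg_eq)
  define coeff :: "(nat \<Rightarrow> 'a poly3) \<Rightarrow> nat \<times> mono3 \<Rightarrow> 'a" where "coeff q = (\<lambda>(n, m). lookup (q n) m)" for q
  have coeff_index: "coeff q b = 0" if "q \<in> B_space" "b \<notin> B_index" for q b
    using B_space_index[OF that(1)] that(2) by (cases b) (auto simp: coeff_def)
  have coeff_lincomb: "coeff (lincomb K \<alpha> v) b = (\<Sum>k\<in>K. \<alpha> k * coeff (v k) b)" for K :: "'k set" and \<alpha> v b
    by (cases b) (simp add: coeff_def lookup_lincomb)
  have coeff_inject: "q = r" if "\<And>b. coeff q b = coeff r b" for q r
  proof (intro ext poly_mapping_eqI)
    show "lookup (q n) m = lookup (r n) m" for n m using that[of "(n, m)"] by (simp add: coeff_def)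
  qed
  have "\<exists>q. q \<in> B_space \<and> relation_map k f0 q = single m 1" if "m \<in> M" for m
  proof -
    have s: "single m 1 \<in> Hom j \<delta>" using that by (intro Hom_single) (simp add: M_def)
    from surj[OF this] show ?thesis using relation_surjective[OF f0 s] by metis
  qed
  then obtain qs where qs: "\<And>m. m \<in> M \<Longrightarrow> qs m \<in> B_space" "\<And>m. m \<in> M \<Longrightarrow> relation_map k f0 (qs m) = single m 1"
    by metis
  have supp: "coeff (trivial_relation k f0 p) b = 0" if "p \<in> A_space" "b \<notin> B_index" for p b
    using coeff_index[OF trivial_relation_in_B_space[OF f0 that(1)] that(2)] .
  obtain C :: "(nat \<Rightarrow> 'a poly3) set" where C: "finite C" "C \<subseteq> A_space"
    "indep C (\<lambda>p. coeff (trivial_relation k f0 p))"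
    "\<And>p. p \<in> A_space \<Longrightarrow> \<exists>\<alpha>. \<forall>b. coeff (trivial_relation k f0 p) b = (\<Sum>p\<in>C. \<alpha> p * coeff (trivial_relation k f0 p) b)"
    using maximal_indep[where v = "\<lambda>p. coeff (trivial_relation k f0 p)", OF finite_B_index supp] by blast
  define K where "K = M <+> C"
  have finK: "finite K" unfolding K_def using finM C(1) by simp
  define vec where "vec f x = (case x of Inl m \<Rightarrow> qs m | Inr p \<Rightarrow> trivial_relation k f p)" for f x
  have sumK: "(\<Sum>x\<in>K. G x) = (\<Sum>m\<in>M. G (Inl m)) + (\<Sum>p\<in>C. G (Inr p))" for G :: "_ \<Rightarrow> 'a"
    unfolding K_def using finM C(1) by (simp add: sum.Plus)
  have vec_in: "vec f x \<in> B_space" if "f \<in> hspace d1 d2 d3" "x \<in> K" for f x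
    using that qs(1) C(2) trivial_relation_in_B_space[OF that(1)] by (auto simp: K_def vec_def)
  have map_comb: "lookup (relation_map k f (lincomb K \<alpha> (vec f))) m' =
      (\<Sum>m\<in>M. \<alpha> (Inl m) * lookup (relation_map k f (qs m)) m')" for f \<alpha> m'
    by (simp add: lookup_relation_map_lincomb sumK vec_def)
  have unit0: "(\<Sum>m\<in>M. \<alpha> m * lookup (relation_map k f0 (qs m)) m') = \<alpha> m'" if "m' \<in> M" for \<alpha> m'
  proof -
    have "(\<Sum>m\<in>M. \<alpha> m * lookup (relation_map k f0 (qs m)) m') = (\<Sum>m\<in>M. if m = m' then \<alpha> m else 0)"
      by (intro sum.cong) (auto simp: qs(2) lookup_single when_def)
    then show ?thesis using that finM by simp
  qed
  have indM: "indep M (\<lambda>m. lookup (relation_map k f0 (qs m)))"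
    by (rule indepI) (metis unit0)
  have indK: "indep K (\<lambda>x. coeff (vec f0 x))"
  proof (rule indepI)
    fix \<alpha> x assume z: "\<And>b. (\<Sum>x\<in>K. \<alpha> x * coeff (vec f0 x) b) = 0" and x: "x \<in> K"
    have "coeff (lincomb K \<alpha> (vec f0)) b = coeff (\<lambda>n. 0) b" for b
      unfolding coeff_lincomb z by (simp add: coeff_def split: prod.split)
    then have "lincomb K \<alpha> (vec f0) = (\<lambda>n. 0)" by (rule coeff_inject)
    then have "(\<Sum>m\<in>M. \<alpha> (Inl m) * lookup (relation_map k f0 (qs m)) m') = 0" for m'
      using map_comb[of f0 \<alpha> m'] by (simp add: relation_map_def)
    then have l: "\<alpha> (Inl m) = 0" if "m \<in> M" for m using unit0[OF that, of "\<lambda>m. \<alpha> (Inl m)"] by simp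
    have "(\<Sum>p\<in>C. \<alpha> (Inr p) * coeff (trivial_relation k f0 p) b) = 0" for b
      using z[of b] l by (simp add: sumK vec_def)
    then have "\<alpha> (Inr p) = 0" if "p \<in> C" for p
      using indepD[OF C(3), of "\<lambda>p. \<alpha> (Inr p)"] that by blast
    with l x show "\<alpha> x = 0" by (auto simp: K_def)
  qed
  \<comment> \<open>Subtracting the combination of \<open>qs\<close> with the same image leaves a
    kernel element, which is trivial by exactness at \<open>f0\<close>.\<close>
  have span0: "\<exists>\<alpha>. \<forall>b. coeff q b = (\<Sum>x\<in>K. \<alpha> x * coeff (vec f0 x) b)" if q: "q \<in> B_space" for q
  proof -
    define \<beta> where "\<beta> m = lookup (relation_map k f0 q) m" for m
    define r where "r n = q n - lincomb M \<beta> qs n" for n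
    have r: "r \<in> B_space"
      unfolding r_def using q qs(1) by (intro B_space_diff B_space_lincomb) auto
    have "relation_map k f0 r = relation_map k f0 q - relation_map k f0 (lincomb M \<beta> qs)"
      by (simp add: relation_map_def r_def algebra_simps)
    moreover have "lookup (relation_map k f0 q) m = lookup (relation_map k f0 (lincomb M \<beta> qs)) m" for m
    proof (cases "m \<in> M")
      case True
      then show ?thesis using unit0[OF True, of \<beta>] by (simp add: lookup_relation_map_lincomb \<beta>_def)
    next
      case False
      have z: "lookup h m = 0" if "h \<in> Hom j \<delta>" for h :: "'a poly3"
        using HomD[OF that, of m] False by (auto simp: M_def)
      have "relation_map k f0 q \<in> Hom j \<delta>" "relation_map k f0 (lincomb M \<beta> qs) \<in> Hom j \<delta>"
        using q qs(1) by (intro relation_map_Hom[OF f0] B_space_lincomb; simp)+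
      then show ?thesis by (simp add: z)
    qed
    ultimately have rz: "relation_map k f0 r = 0" by (intro poly_mapping_eqI) (simp add: lookup_minus)
    have "\<exists>p. p \<in> A_space \<and> r = trivial_relation k f0 p"
    proof (rule relation_exact[OF f0 _ _ r rz])
      show "g \<in> ideal_of f0" if "g \<in> Hom i \<delta>" "X3 ^ k * g \<in> ideal_of f0" for g by (rule inj[OF that])
      show "\<exists>u v w. h1 = u * fst (snd f0) + v * snd (snd f0) \<and> h2 = - u * fst f0 + w * snd (snd f0) \<and>
          h3 = - v * fst f0 - w * fst (snd f0)"
        if "h1 * fst f0 + h2 * fst (snd f0) + h3 * snd (snd f0) = 0" for h1 h2 h3
        by (rule koszul[OF that])
    qed blast
    then obtain p where p: "p \<in> A_space" "r = trivial_relation k f0 p" by blast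
    then obtain \<gamma> where \<gamma>: "\<And>b. coeff r b = (\<Sum>p\<in>C. \<gamma> p * coeff (trivial_relation k f0 p) b)"
      using C(4) by blast
    have "coeff q b = coeff (lincomb M \<beta> qs) b + coeff r b" for b
      by (cases b) (simp add: coeff_def r_def lookup_minus)
    then have "coeff q b = (\<Sum>x\<in>K. (case x of Inl m \<Rightarrow> \<beta> m | Inr p \<Rightarrow> \<gamma> p) * coeff (vec f0 x) b)" for b
      by (simp add: sumK vec_def \<gamma> coeff_lincomb)
    then show ?thesis by blast
  qed
  have "\<exists>\<alpha>. \<forall>b'. (if b' = b then 1 else 0) = (\<Sum>x\<in>K. \<alpha> x * coeff (vec f0 x) b')" if b: "b \<in> B_index" for b
  proof -
    obtain n m where nm: "b = (n, m)" by (cases b)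
    have "coeff (\<lambda>n'. if n' = n then single m 1 else 0) b' = (if b' = b then 1 else 0)" for b'
      by (cases b') (auto simp: coeff_def nm lookup_single when_def)
    with span0[OF B_space_unit, of n m] b show ?thesis by (simp add: nm)
  qed
  \<comment> \<open>This count, obtained at \<open>f0\<close>, does not mention \<open>f\<close>:
    wherever the family is independent it spans \<open>B_space\<close>.\<close>
  then have cardK: "card B_index \<le> card K"
    by (rule spanning_card_ge[OF finK finite_B_index])
  have pf_vec: "polyfun (\<lambda>f. coeff (vec f x) b)" for x b
  proof -
    obtain n m where nm: "b = (n, m)" by (cases b)
    have "polyfam (\<lambda>f. vec f x n)"
    proof (cases x)
      case (Inr p)
      consider "n = 0" | "n = 1" | "n = 2" | "n = 3" | "n > 3" by linarith
      then show ?thesis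
        by cases (simp_all add: Inr vec_def trivial_relation_def polyfam_intros)
    qed (simp add: vec_def polyfam_const)
    then show ?thesis by (simp add: coeff_def nm polyfam_lookup)
  qed
  have pf_map: "polyfun (\<lambda>f. lookup (relation_map k f (qs m)) m')" for m m'
    by (rule polyfam_lookup) (simp add: relation_map_def polyfam_intros)
  have "principal_generic d1 d2 d3 (\<lambda>f. indep M (\<lambda>m. lookup (relation_map k f (qs m))) \<and>
      indep K (\<lambda>x. coeff (vec f x)))"
    by (intro principal_generic_conj
        principal_generic_indep[where v = "\<lambda>f m. lookup (relation_map k f (qs m))", OF finM pf_map f0 indM]
        principal_generic_indep[where v = "\<lambda>f x. coeff (vec f x)", OF finK pf_vec f0 indK])
  then show ?thesis
  proof (rule principal_generic_mono)
    fix f assume f: "f \<in> hspace d1 d2 d3"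
      and ind: "indep M (\<lambda>m. lookup (relation_map k f (qs m))) \<and> indep K (\<lambda>x. coeff (vec f x))"
    note iM = conjunct1[OF ind] and iK = conjunct2[OF ind]
    show "multiplication_bijective f"
      unfolding multiplication_bijective_def
    proof (intro conjI ballI impI)
      fix s :: "'a poly3" assume s: "s \<in> Hom j \<delta>"
      have "lookup (relation_map k f (qs m)) m' = 0" if "m \<in> M" "m' \<notin> M" for m m'
        using HomD[OF relation_map_Hom[OF f qs(1)[OF that(1)]], of m'] that(2) by (auto simp: M_def)
      moreover have "lookup s m' = 0" if "m' \<notin> M" for m'
        using HomD[OF s, of m'] that by (auto simp: M_def)
      ultimately obtain \<alpha> where "\<And>m'. lookup s m' = (\<Sum>m\<in>M. \<alpha> m * lookup (relation_map k f (qs m)) m')"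
        using indep_span[OF finM finM iM order_refl, of "lookup s"] by blast
      then have s_eq: "s = relation_map k f (lincomb M \<alpha> qs)"
        by (intro poly_mapping_eqI) (simp add: lookup_relation_map_lincomb)
      have "lincomb M \<alpha> qs \<in> B_space" using qs(1) by (rule B_space_lincomb)
      then have "lincomb M \<alpha> qs 0 \<in> Hom i \<delta>" by (simp add: B_space_def)
      moreover have "s - X3 ^ k * lincomb M \<alpha> qs 0 \<in> ideal_of f"
        unfolding s_eq relation_map_def gen_ideal3_def
        by (intro CollectI exI[of _ "- lincomb M \<alpha> qs 1"] exI[of _ "- lincomb M \<alpha> qs 2"]
            exI[of _ "- lincomb M \<alpha> qs 3"]) simp
      ultimately show "\<exists>g\<in>Hom i \<delta>. s - X3 ^ k * g \<in> ideal_of f" by blast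
    next
      fix g :: "'a poly3" assume g: "g \<in> Hom i \<delta>" and Xg: "X3 ^ k * g \<in> ideal_of f"
      \<comment> \<open>A preimage of 0 with zeroth entry \<open>g\<close> encodes that
        \<open>X3 ^ k * g\<close> lies in the ideal.\<close>
      have "0 - X3 ^ k * g \<in> ideal_of f" using gen_ideal3_mult[OF Xg, of "- 1"] by simp
      then obtain q where q: "q \<in> B_space" "relation_map k f q = 0" "q 0 = g"
        by (rule relation_surjective[OF f Hom_zero g])
      obtain \<alpha> where \<alpha>: "\<And>b. coeff q b = (\<Sum>x\<in>K. \<alpha> x * coeff (vec f x) b)"
        by (rule indep_span[OF finK finite_B_index iK cardK, of "coeff q"])
          (use coeff_index q(1) vec_in[OF f] in auto)
      have q_eq: "q = lincomb K \<alpha> (vec f)"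
        by (rule coeff_inject) (simp add: \<alpha> coeff_lincomb)
      have "(\<Sum>m\<in>M. \<alpha> (Inl m) * lookup (relation_map k f (qs m)) m') = 0" for m'
        using map_comb[of f \<alpha> m'] q(2) by (simp add: q_eq)
      then have l: "\<alpha> (Inl m) = 0" if "m \<in> M" for m
        using indepD[OF iM, of "\<lambda>m. \<alpha> (Inl m)"] that by blast
      have "g = (\<Sum>x\<in>K. single 0 (\<alpha> x) * vec f x 0)"
        using q(3) by (simp add: q_eq lincomb_def)
      also have "\<dots> \<in> ideal_of f"
      proof (rule gen_ideal3_sum)
        fix x assume "x \<in> K"
        then show "single 0 (\<alpha> x) * vec f x 0 \<in> ideal_of f"
        proof (cases x)
          case (Inl m)
          then show ?thesis using l \<open>x \<in> K\<close> by (auto simp: K_def gen_ideal3_zero)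
        next
          case (Inr p)
          have "trivial_relation k f p 0 \<in> ideal_of f"
            unfolding trivial_relation_def gen_ideal3_def by auto
          then show ?thesis by (simp add: Inr vec_def gen_ideal3_mult)
        qed
      qed
      finally show "g \<in> ideal_of f" .
    qed
  qed
qed

end

section \<open>Vanishing orders at a general point\<close>

lemma pderiv_sum: "pderiv (\<Sum>k\<in>K. f k) = (\<Sum>k\<in>K. pderiv (f k))"
  using higher_pderiv_sum[of 1 f K] by simp

text \<open>For nonconstant \<open>u\<close> and \<open>v\<close>, the top coefficients of the two
  sides are the same product of leading coefficients, multiplied by the degree of \<open>u\<close>
  and of \<open>v\<close> respectively; characteristic zero lets these be compared.\<close>

lemma degree_eq_if_wronskian_zero:
  fixes u v :: "'a::field_char_0 poly"
  assumes nz: "u \<noteq> 0" "v \<noteq> 0" and w: "v * pderiv u = pderiv v * u"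
  shows "Polynomial.degree u = Polynomial.degree v"
proof (cases "Polynomial.degree u = 0 \<or> Polynomial.degree v = 0")
  case True
  then have "pderiv u = 0 \<or> pderiv v = 0" by (simp add: pderiv_eq_0_iff)
  then have "pderiv u = 0 \<and> pderiv v = 0" using nz w by auto
  then show ?thesis by (simp add: pderiv_eq_0_iff)
next
  case False
  define m where "m = Polynomial.degree u - 1"
  define n where "n = Polynomial.degree v - 1"
  have d: "Polynomial.degree u = Suc m" "Polynomial.degree v = Suc n" using False by (auto simp: m_def n_def)
  have "coeff (v * pderiv u) (Suc n + m) = lead_coeff v * (of_nat (Suc m) * lead_coeff u)"
    using coeff_mult_degree_sum[of v "pderiv u"] by (simp add: degree_pderiv d coeff_pderiv)
  moreover have "coeff (pderiv v * u) (n + Suc m) = of_nat (Suc n) * lead_coeff v * lead_coeff u"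
    using coeff_mult_degree_sum[of "pderiv v" u] by (simp add: degree_pderiv d coeff_pderiv)
  ultimately have "of_nat (Suc m) * (lead_coeff v * lead_coeff u) = of_nat (Suc n) * (lead_coeff v * lead_coeff u)"
    using w by (simp add: mult_ac)
  then have "of_nat (Suc m) = (of_nat (Suc n) :: 'a)" using nz by simp
  then show ?thesis unfolding d by (simp only: of_nat_eq_iff)
qed

text \<open>The constant is chosen to cancel the coefficient of \<open>u\<close> at the degree of
  \<open>v\<close>. The difference still has Wronskian zero with \<open>v\<close>, so if nonzero it
  would have that degree and a nonzero coefficient there.\<close>

lemma proportional_if_wronskian_zero:
  fixes u v :: "'a::field_char_0 poly"
  assumes v: "v \<noteq> 0" and w: "v * pderiv u = pderiv v * u"
  obtains c where "u = smult c v"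
proof -
  define c where "c = coeff u (Polynomial.degree v) / lead_coeff v"
  define r where "r = u - smult c v"
  have c0: "coeff r (Polynomial.degree v) = 0" using v by (simp add: r_def c_def)
  have "v * pderiv r = pderiv v * r"
    using w by (simp add: r_def pderiv_diff pderiv_smult algebra_simps)
  then have "r = 0"
    using degree_eq_if_wronskian_zero[of r v] v c0 by (metis leading_coeff_0_iff)
  then show ?thesis using that[of c] by (simp add: r_def)
qed

lemma power_dvd_pderiv:
  fixes p q :: "'a::idom poly"
  assumes "p ^ Suc n dvd q"
  shows "p ^ n dvd pderiv q"
proof -
  from assms obtain h where q: "q = p ^ Suc n * h" by (elim dvdE)
  have "pderiv q = p ^ n * (p * pderiv h + smult (of_nat (Suc n)) (h * pderiv p))"
    unfolding q pderiv_mult pderiv_power_Suc by (simp add: algebra_simps)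
  then show ?thesis by simp
qed

text \<open>The induction replaces the family \<open>w\<close> by the Wronskians \<open>w r * w k' - w r' * w k\<close>; these are
  independent in characteristic zero, and the vanishing order drops by one.\<close>

lemma general_vanishing_order:
  fixes w :: "nat \<Rightarrow> 'a::field_char_0 poly"
  assumes "indep {..<r} (\<lambda>k. coeff (w k))"
  shows "\<exists>Z. finite Z \<and> (\<forall>t. t \<notin> Z \<longrightarrow> (\<forall>\<alpha>. [:- t, 1:] ^ r dvd (\<Sum>k<r. smult (\<alpha> k) (w k)) \<longrightarrow> (\<forall>k<r. \<alpha> k = 0)))"
  using assms
proof (induction r arbitrary: w)
  case 0
  then show ?case by (intro exI[of _ "{}"]) simp
next
  case (Suc r)
  define v where "v = w r"
  have i: "indep (insert r {..<r}) (\<lambda>k. coeff (w k))" using Suc.prems by (simp add: lessThan_Suc)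
  obtain b where "coeff (w r) b \<noteq> 0" by (rule indep_insert_nonzero[OF _ i]) simp
  then have v: "v \<noteq> 0" by (auto simp: v_def)
  define w' where "w' k = v * pderiv (w k) - pderiv v * w k" for k
  have w': "(\<Sum>k<r. smult (\<alpha> k) (w' k)) = v * pderiv (\<Sum>k<r. smult (\<alpha> k) (w k)) - pderiv v * (\<Sum>k<r. smult (\<alpha> k) (w k))"
    for \<alpha>
    by (simp add: w'_def pderiv_sum pderiv_smult sum_distrib_left smult_diff_right sum_subtractf)
  have "indep {..<r} (\<lambda>k. coeff (w' k))"
  proof (rule indepI)
    fix \<alpha> k assume z: "\<And>b. (\<Sum>k<r. \<alpha> k * coeff (w' k) b) = 0" and k: "k \<in> {..<r}"
    let ?u = "\<Sum>k<r. smult (\<alpha> k) (w k)"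
    have "(\<Sum>k<r. smult (\<alpha> k) (w' k)) = 0" by (rule poly_eqI) (simp add: coeff_sum z)
    then have "v * pderiv ?u = pderiv v * ?u" unfolding w' by simp
    then obtain c where c: "?u = smult c v" by (rule proportional_if_wronskian_zero[OF v])
    define \<beta> where "\<beta> k = (if k = r then - c else \<alpha> k)" for k
    have "(\<Sum>k\<in>insert r {..<r}. \<beta> k * coeff (w k) b) = 0" for b
    proof -
      have "(\<Sum>k<r. \<beta> k * coeff (w k) b) = (\<Sum>k<r. \<alpha> k * coeff (w k) b)"
        by (intro sum.cong) (auto simp: \<beta>_def)
      also have "\<dots> = coeff ?u b" by (simp add: coeff_sum)
      also have "\<dots> = c * coeff v b" by (simp add: c)
      finally show ?thesis by (simp add: \<beta>_def v_def)
    qed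
    from indepD[OF i this, of k] k show "\<alpha> k = 0" by (auto simp: \<beta>_def split: if_splits)
  qed
  from Suc.IH[OF this] obtain Z where Z: "finite Z"
    "\<And>t \<alpha>. t \<notin> Z \<Longrightarrow> [:- t, 1:] ^ r dvd (\<Sum>k<r. smult (\<alpha> k) (w' k)) \<Longrightarrow> \<forall>k<r. \<alpha> k = 0" by blast
  \<comment> \<open>Roots of \<open>v\<close> are excluded so that, once the other coefficients
    vanish, divisibility forces \<open>\<alpha> r = 0\<close>.\<close>
  show ?case
  proof (intro exI[of _ "Z \<union> {t. poly v t = 0}"] conjI allI impI)
    show "finite (Z \<union> {t. poly v t = 0})" using Z(1) v by (simp add: poly_roots_finite)
    fix t \<alpha> k
    assume t: "t \<notin> Z \<union> {t. poly v t = 0}" and k: "k < Suc r"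
      and dvd: "[:- t, 1:] ^ Suc r dvd (\<Sum>k<Suc r. smult (\<alpha> k) (w k))"
    let ?u = "\<Sum>k<r. smult (\<alpha> k) (w k)" and ?l = "[:- t, 1:]"
    have s: "(\<Sum>k<Suc r. smult (\<alpha> k) (w k)) = ?u + smult (\<alpha> r) v" by (simp add: v_def)
    \<comment> \<open>The Wronskian with \<open>v\<close> does not see a multiple of
      \<open>v\<close>, so the term with \<open>\<alpha> r\<close> drops out; differentiation costs
      one order of vanishing.\<close>
    have "?l ^ r dvd v * pderiv (?u + smult (\<alpha> r) v) - pderiv v * (?u + smult (\<alpha> r) v)"
      using power_dvd_pderiv[OF dvd] power_le_dvd[OF dvd, of r] unfolding s
      by (intro dvd_diff dvd_mult) simp_all
    also have "v * pderiv (?u + smult (\<alpha> r) v) - pderiv v * (?u + smult (\<alpha> r) v) = (\<Sum>k<r. smult (\<alpha> k) (w' k))"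
      unfolding w' by (simp add: pderiv_add pderiv_smult algebra_simps)
    finally have \<alpha>: "\<forall>k<r. \<alpha> k = 0" using Z(2) t by blast
    then have "?l ^ Suc r dvd smult (\<alpha> r) v" using dvd unfolding s by simp
    then have "?l dvd smult (\<alpha> r) v" by (rule dvd_trans[rotated]) (simp only: power_Suc dvd_triv_left)
    then have "poly (smult (\<alpha> r) v) t = 0" by (simp only: poly_eq_0_iff_dvd)
    then have "\<alpha> r = 0" using t by simp
    with \<alpha> k show "\<alpha> k = 0" by (auto simp: less_Suc_eq)
  qed
qed

section \<open>Dehomogenization modulo \<open>x3\<close>\<close>

text \<open>The restriction to x3 = 0 in the chart x1 = 1. Among forms of one degree a lower power
  of the variable belongs to a larger monomial, so for a nonzero restriction the vanishing order at
  0 is the x2-exponent of the leading monomial.\<close>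

definition dehom :: "'a::comm_ring_1 poly3 \<Rightarrow> 'a poly" where
  "dehom = eval3 (\<lambda>a. [:a:]) 1 [:0, 1:] 0"

interpretation dehom: eval3_hom "\<lambda>a :: 'a::comm_ring_1. [:a:]" 1 "[:0, 1:]" 0
  rewrites "eval3 (\<lambda>a :: 'a. [:a:]) 1 [:0, 1:] 0 = dehom"
  by unfold_locales (simp_all add: dehom_def one_pCons)

lemma coeff_dehom:
  assumes "g \<in> Hom d 0"
  shows "coeff (dehom g) b = (if b \<le> d then lookup g (d - b, b, 0) else 0)"
proof -
  have "coeff (dehom g) b = (\<Sum>m\<in>keys g. coeff ([:lookup g m:] * (case m of (i, j, k) \<Rightarrow> 1 ^ i * [:0, 1:] ^ j * 0 ^ k)) b)"
    by (simp add: dehom_def eval3_def coeff_sum)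
  also have "\<dots> = (\<Sum>m\<in>keys g. if m = (d - b, b, 0) then (if b \<le> d then lookup g m else 0) else 0)"
  proof (intro sum.cong refl)
    fix m assume "m \<in> keys g"
    then have "mdeg m = d" using HomD[OF assms, of m] by (simp add: in_keys_iff)
    moreover obtain i j k where m: "m = (i, j, k)" by (cases m)
    ultimately have d: "i + j + k = d" by (simp add: mdeg_def)
    have "coeff ([:0, 1:] ^ j) b = (if j = b then 1 else 0 :: 'a)"
      using monom_altdef[of "1 :: 'a" j] by (simp flip: coeff_monom)
    then show "coeff ([:lookup g m:] * (case m of (i, j, k) \<Rightarrow> 1 ^ i * [:0, 1:] ^ j * 0 ^ k)) b
        = (if m = (d - b, b, 0) then (if b \<le> d then lookup g m else 0) else 0)"
      using d by (cases "k = 0") (auto simp: m zero_power)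
  qed
  also have "\<dots> = (if b \<le> d then lookup g (d - b, b, 0) else 0)"
    by (simp add: in_keys_iff)
  finally show ?thesis .
qed

lemma pcompose_power: "pcompose (p ^ n) q = pcompose p q ^ n" for p :: "'a::comm_ring_1 poly"
  by (induction n) (simp_all add: pcompose_mult pcompose_1)

text \<open>The shift of x2 becomes a translation of the affine line, so vanishing at 0 after it is
  vanishing at \<open>t\<close> before it.\<close>

lemma dehom_shift:
  "dehom (subst X1 (X2 + single 0 t * X1) X3 f) = pcompose (dehom f) [:t, 1:]"
proof (induction f rule: poly_mapping_induct)
  case (single m c)
  obtain i j k where m: "m = (i, j, k)" by (cases m)
  show ?case
    unfolding m single_eq_X_powers
    by (cases "k = 0") (simp_all add: zero_power pcompose_smult subst.ev_mult subst.ev_power subst.ev_const subst.ev_X dehom.ev_mult dehom.ev_power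
        dehom.ev_const dehom.ev_X dehom.ev_add pcompose_mult pcompose_power pcompose_pCons)
qed (simp_all add: subst.ev_zero subst.ev_add dehom.ev_zero dehom.ev_add pcompose_add)

definition restriction_coeff :: "nat \<Rightarrow> 'a::zero poly3 \<Rightarrow> nat \<Rightarrow> 'a" where
  "restriction_coeff d g b = (if b \<le> d then lookup g (d - b, b, 0) else 0)"

text \<open>Here \<open>r\<close> is the dimension of the restriction to x3 = 0 of the degree
  \<open>d\<close> part of the ideal. The first condition gives a reduced echelon basis with pivots
  at the \<open>r\<close> largest monomials; the second says that the restriction contains nothing
  beyond its span.\<close>

definition initial_segment :: "nat \<Rightarrow> 'a::comm_ring_1 poly3 \<times> 'a poly3 \<times> 'a poly3 \<Rightarrow> bool" where
  "initial_segment d f \<longleftrightarrow> (\<exists>r.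
     (\<forall>b<r. \<exists>g\<in>ideal_of f \<inter> Hom d 0. \<forall>b'<r. restriction_coeff d g b' = (if b' = b then 1 else 0)) \<and>
     (\<forall>g\<in>ideal_of f \<inter> Hom d 0. (\<forall>b<r. restriction_coeff d g b = 0) \<longrightarrow> (\<forall>b. restriction_coeff d g b = 0)))"

text \<open>The dimension \<open>r\<close> is taken maximal over the whole parameter space. A shift
  by a \<open>t\<close> outside the exceptional set makes the first \<open>r\<close> coefficients
  independent, an open condition; maximality excludes a further independent restriction at every
  point.\<close>

theorem generic_initial_segment:
  "principal_generic d1 d2 d3 (initial_segment d :: 'a::field_char_0 poly3 \<times> 'a poly3 \<times> 'a poly3 \<Rightarrow> bool)"
proof -
  let ?V = "\<lambda>f :: 'a poly3 \<times> 'a poly3 \<times> 'a poly3. ideal_of f \<inter> Hom d 0"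
  define P where "P r \<longleftrightarrow> (\<exists>f\<in>hspace d1 d2 d3. \<exists>g. (\<forall>k<r. g k \<in> ?V f) \<and> indep {..<r} (\<lambda>k. restriction_coeff d (g k)))"
    for r :: nat
  have P0: "P 0" unfolding P_def
    by (intro bexI[of _ "(0, 0, 0)"]) (auto simp: hspace_def homogeneous_iff_Hom)
  have bd: "r \<le> d + 1" if Pr: "P r" for r
  proof -
    from Pr obtain g :: "nat \<Rightarrow> 'a poly3" where i: "indep {..<r} (\<lambda>k. restriction_coeff d (g k))"
      unfolding P_def by blast
    have "card {..<r} \<le> card {..d}"
      by (rule indep_card_le[OF _ _ i]) (auto simp: restriction_coeff_def)
    then show ?thesis by simp
  qed
  define r where "r = (GREATEST r. P r)"
  have Pr: "P r" unfolding r_def by (rule GreatestI_nat[of P, OF P0 bd])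
  have r_max: "s \<le> r" if "P s" for s unfolding r_def by (rule Greatest_le_nat[of P, OF that bd])
  obtain f g where f: "f \<in> hspace d1 d2 d3" and g: "\<And>k. k < r \<Longrightarrow> g k \<in> ?V f"
    and ind: "indep {..<r} (\<lambda>k. restriction_coeff d (g k))"
    using Pr unfolding P_def by blast
  have restr: "coeff (dehom h) b = restriction_coeff d h b" if "h \<in> Hom d 0" for h :: "'a poly3" and b
    unfolding coeff_dehom[OF that] restriction_coeff_def ..
  have "indep {..<r} (\<lambda>k. coeff (dehom (g k)))"
    using ind by (subst indep_cong[where w = "\<lambda>k. restriction_coeff d (g k)"]) (use g restr in auto)
  from general_vanishing_order[OF this] obtain Z where Z: "finite Z"
    "\<And>t \<alpha>. t \<notin> Z \<Longrightarrow> [:- t, 1:] ^ r dvd (\<Sum>k<r. smult (\<alpha> k) (dehom (g k))) \<Longrightarrow> \<forall>k<r. \<alpha> k = 0" by blast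
  obtain t :: 'a where t: "t \<notin> Z" using ex_new_if_finite[OF infinite_UNIV_char_0 Z(1)] by blast
  define \<theta> where "\<theta> = subst X1 (X2 + single 0 t * X1) X3"
  have \<theta>_Hom: "\<theta> h \<in> Hom n l" if "h \<in> Hom n l" for h n l
    unfolding \<theta>_def by (intro subst_Hom[OF _ _ _ that] Hom_add Hom_const_times X_Hom)
  define f' where "f' = (\<theta> (fst f), \<theta> (fst (snd f)), \<theta> (snd (snd f)))"
  have f'_in: "f' \<in> hspace d1 d2 d3"
    using f by (auto simp: hspace_def homogeneous_iff_Hom f'_def \<theta>_Hom)
  have f'_Hom: "fst f' \<in> Hom d1 0" "fst (snd f') \<in> Hom d2 0" "snd (snd f') \<in> Hom d3 0"
    using f'_in by (auto simp: hspace_def homogeneous_iff_Hom)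
  have \<theta>g: "\<theta> (g k) \<in> ideal_of f'" "\<theta> (g k) \<in> Hom d 0" if "k < r" for k
    using g[OF that] subst_gen_ideal3[of "g k" "fst f" "fst (snd f)" "snd (snd f)"] \<theta>_Hom
    by (auto simp: f'_def \<theta>_def)
  have "\<exists>h1 h2 h3. h1 \<in> Hom d (0 + d1) \<and> h2 \<in> Hom d (0 + d2) \<and> h3 \<in> Hom d (0 + d3) \<and>
      \<theta> (g k) = h1 * fst f' + h2 * fst (snd f') + h3 * snd (snd f')" if "k < r" for k
    by (rule gen_ideal3_Hom[OF \<theta>g[OF that] f'_Hom]) blast
  then obtain h1 h2 h3 where h: "\<And>k. k < r \<Longrightarrow> h1 k \<in> Hom d (0 + d1)" "\<And>k. k < r \<Longrightarrow> h2 k \<in> Hom d (0 + d2)"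
    "\<And>k. k < r \<Longrightarrow> h3 k \<in> Hom d (0 + d3)"
    "\<And>k. k < r \<Longrightarrow> \<theta> (g k) = h1 k * fst f' + h2 k * fst (snd f') + h3 k * snd (snd f')"
    by metis
  \<comment> \<open>The multipliers are frozen at the shifted point, so these elements follow
    \<open>F\<close> inside its ideal and depend polynomially on it.\<close>
  define G where "G F k = h1 k * fst F + h2 k * fst (snd F) + h3 k * snd (snd F)" for F k
  have G: "G F k \<in> ?V F" if F: "F \<in> hspace d1 d2 d3" and k: "k < r" for F k
  proof -
    have F': "fst F \<in> Hom d1 0" "fst (snd F) \<in> Hom d2 0" "snd (snd F) \<in> Hom d3 0"
      using F by (auto simp: hspace_def homogeneous_iff_Hom)
    have "G F k \<in> Hom d 0"
      unfolding G_def
      by (intro Hom_add Hom_multI[OF h(1)[OF k] F'(1)] Hom_multI[OF h(2)[OF k] F'(2)]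
          Hom_multI[OF h(3)[OF k] F'(3)]) simp_all
    moreover have "G F k \<in> ideal_of F" unfolding G_def gen_ideal3_def by blast
    ultimately show ?thesis by blast
  qed
  define v where "v F k b = (if b < r then restriction_coeff d (G F k) b else 0)" for F k b
  have "indep {..<r} (v f')"
  proof (rule indepI)
    fix \<alpha> k assume z: "\<And>b. (\<Sum>k<r. \<alpha> k * v f' k b) = 0" and k: "k \<in> {..<r}"
    let ?U = "\<Sum>k<r. smult (\<alpha> k) (dehom (g k))"
    have U: "pcompose ?U [:t, 1:] = (\<Sum>k<r. smult (\<alpha> k) (dehom (\<theta> (g k))))"
      by (simp add: pcompose_sum pcompose_smult \<theta>_def dehom_shift)
    have "coeff (pcompose ?U [:t, 1:]) b = 0" if "b < r" for b
    proof -
      have "coeff (pcompose ?U [:t, 1:]) b = (\<Sum>k<r. \<alpha> k * coeff (dehom (\<theta> (g k))) b)"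
        unfolding U by (simp add: coeff_sum)
      also have "\<dots> = (\<Sum>k<r. \<alpha> k * v f' k b)"
        using that by (intro sum.cong) (auto simp: v_def G_def h(4) restr \<theta>g simp flip: h(4))
      finally show ?thesis by (simp add: z)
    qed
    \<comment> \<open>Vanishing of the first \<open>r\<close> coefficients is divisibility by the
      r-th power of the variable; translating back makes it vanishing of order \<open>r\<close> at
      \<open>t\<close>, where the choice of \<open>t\<close> applies.\<close>
    then have "Polynomial.monom 1 r dvd pcompose ?U [:t, 1:]" unfolding monom_1_dvd_iff' by blast
    then have "[:0, 1:] ^ r dvd pcompose ?U [:t, 1:]" by (simp only: monom_altdef smult_1_left)
    then obtain q where q: "pcompose ?U [:t, 1:] = [:0, 1:] ^ r * q" by (elim dvdE)
    have "?U = pcompose (pcompose ?U [:t, 1:]) [:- t, 1:]"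
      by (simp add: pcompose_pCons flip: pcompose_assoc)
    also have "\<dots> = [:- t, 1:] ^ r * pcompose q [:- t, 1:]"
      unfolding q by (simp add: pcompose_mult pcompose_power pcompose_pCons)
    finally have "[:- t, 1:] ^ r dvd ?U" by (rule dvdI)
    then show "\<alpha> k = 0" using Z(2)[OF t] k by blast
  qed
  moreover have "polyfun (\<lambda>F. v F k b)" for k b
  proof (cases "b < r \<and> b \<le> d")
    case True
    have "polyfam (\<lambda>F. G F k)" unfolding G_def by (intro polyfam_intros)
    then show ?thesis using True by (simp add: v_def restriction_coeff_def polyfam_lookup)
  next
    case False
    then have "v F k b = 0" for F by (auto simp: v_def restriction_coeff_def)
    then show ?thesis by (simp add: polyfun_const)
  qed
  ultimately have "principal_generic d1 d2 d3 (\<lambda>F. indep {..<r} (v F))"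
    using f'_in by (intro principal_generic_indep) auto
  then show ?thesis
  proof (rule principal_generic_mono)
    fix F assume F: "F \<in> hspace d1 d2 d3" and iF: "indep {..<r} (v F)"
    show "initial_segment d F"
      unfolding initial_segment_def
    proof (intro exI[of _ r] conjI allI impI ballI)
      fix b assume b: "b < r"
      obtain \<alpha> where \<alpha>: "\<And>b'. (if b' = b then 1 else 0) = (\<Sum>k<r. \<alpha> k * v F k b')"
        by (rule indep_span[OF _ _ iF, of "{..<r}" "\<lambda>b'. if b' = b then 1 else 0"]) (use b in \<open>auto simp: v_def\<close>)
      let ?g = "\<Sum>k<r. single 0 (\<alpha> k) * G F k"
      have "?g \<in> ?V F"
        using G[OF F] by (auto intro!: gen_ideal3_sum gen_ideal3_mult Hom_sum Hom_const_times)
      moreover have "restriction_coeff d ?g b' = (if b' = b then 1 else 0)" if "b' < r" for b'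
        using that unfolding \<alpha> by (simp add: v_def restriction_coeff_def lookup_sum)
      ultimately show "\<exists>g\<in>?V F. \<forall>b'<r. restriction_coeff d g b' = (if b' = b then 1 else 0)" by blast
    next
      fix g b assume g: "g \<in> ?V F" and z: "\<forall>b<r. restriction_coeff d g b = 0"
      show "restriction_coeff d g b = 0"
      proof (rule ccontr)
        assume nz: "restriction_coeff d g b \<noteq> 0"
        define g' where "g' k = (if k < r then G F k else g)" for k
        have "indep {..<Suc r} (\<lambda>k. restriction_coeff d (g' k))"
        proof (rule indepI)
          fix \<alpha> k assume "\<And>b. (\<Sum>k<Suc r. \<alpha> k * restriction_coeff d (g' k) b) = 0" and k: "k \<in> {..<Suc r}"
          then have s: "(\<Sum>k<r. \<alpha> k * restriction_coeff d (G F k) b) + \<alpha> r * restriction_coeff d g b = 0" for b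
            by (simp add: g'_def)
          have "(\<Sum>k<r. \<alpha> k * v F k b) = 0" for b
            using s[of b] z by (cases "b < r") (simp_all add: v_def)
          then have \<alpha>: "\<alpha> k = 0" if "k < r" for k using indepD[OF iF] that by blast
          then have "\<alpha> r = 0" using s[of b] nz by simp
          with \<alpha> k show "\<alpha> k = 0" by (auto simp: less_Suc_eq)
        qed
        then have "P (Suc r)"
          unfolding P_def using F G[OF F] g by (intro bexI[of _ F] exI[of _ g']) (auto simp: g'_def)
        then show False using r_max by fastforce
      qed
    qed
  qed
qed

section \<open>Leading monomials and the initial ideal\<close>

lemma mono_gt_asym: "mono_gt a b \<Longrightarrow> \<not> mono_gt b a"
  by (cases a; cases b) (auto simp: mono_gt_def revlex_gt_def)

lemma mono_gt_trans: "mono_gt a b \<Longrightarrow> mono_gt b c \<Longrightarrow> mono_gt a c"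
  by (cases a; cases b; cases c) (auto simp: mono_gt_def revlex_gt_def)

lemma mono_gt_total: "a \<noteq> b \<Longrightarrow> mono_gt a b \<or> mono_gt b a"
  by (cases a; cases b) (auto simp: mono_gt_def revlex_gt_def)

lemma mono_gt_add: "mono_gt a b \<Longrightarrow> mono_gt (n + a) (n + b)"
  by (cases a; cases b; cases n) (auto simp: mono_gt_def revlex_gt_def mdeg_def)

definition is_lead :: "'a::zero poly3 \<Rightarrow> mono3 \<Rightarrow> bool" where
  "is_lead g u \<longleftrightarrow> u \<in> keys g \<and> (\<forall>m\<in>keys g. m \<noteq> u \<longrightarrow> mono_gt u m)"

lemma lead_mono_eq: "is_lead g u \<Longrightarrow> lead_mono g = u"
  unfolding lead_mono_def
proof (rule the_equality)
  assume u: "is_lead g u"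
  then show "u \<in> keys g \<and> (\<forall>m'\<in>keys g. m' \<noteq> u \<longrightarrow> mono_gt u m')"
    unfolding is_lead_def .
  fix m assume m: "m \<in> keys g \<and> (\<forall>m'\<in>keys g. m' \<noteq> m \<longrightarrow> mono_gt m m')"
  show "m = u"
  proof (rule ccontr)
    assume "m \<noteq> u"
    then have "mono_gt m u" "mono_gt u m" using u m unfolding is_lead_def by auto
    then show False using mono_gt_asym by blast
  qed
qed

lemma is_lead_lead_mono:
  assumes "g \<noteq> 0" shows "is_lead g (lead_mono g)"
proof -
  have "\<exists>u\<in>A. \<forall>m\<in>A. m \<noteq> u \<longrightarrow> mono_gt u m" if "finite A" "A \<noteq> {}" for A
    using that
  proof (induction A rule: finite_ne_induct)
    case (insert x A)
    then obtain u where u: "u \<in> A" "\<forall>m\<in>A. m \<noteq> u \<longrightarrow> mono_gt u m" by blast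
    then have "x \<noteq> u" using insert.hyps by blast
    then consider "mono_gt x u" | "mono_gt u x" using mono_gt_total by blast
    then show ?case
    proof cases
      case 1
      then have "mono_gt x m" if "m \<in> A" for m using u that mono_gt_trans by (cases "m = u") blast+
      then show ?thesis by blast
    next
      case 2
      then show ?thesis using u by blast
    qed
  qed simp
  from this[of "keys g"] obtain u where "is_lead g u"
    using assms unfolding is_lead_def by (auto simp: keys_eq_empty)
  then show ?thesis by (simp add: lead_mono_eq)
qed

lemma monom_in_initial_ideal:
  fixes g :: "'a::comm_ring_1 poly3"
  assumes "g \<in> I" "is_lead g u"
  shows "Defs.monom u \<in> initial_ideal I"
proof -
  have "g \<noteq> 0" using assms(2) by (auto simp: is_lead_def)
  then have "(Defs.monom u :: 'a poly3) \<in> {Defs.monom (lead_mono g) | g. g \<in> I \<and> g \<noteq> 0}"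
    using assms lead_mono_eq by blast
  then show ?thesis
    unfolding initial_ideal_def ideal_gen_def
    by (intro CollectI exI[of _ "{Defs.monom u}"] exI[of _ "\<lambda>p. 1"] conjI) simp_all
qed

lemma is_lead_single_times:
  fixes g :: "'a::comm_ring_1 poly3"
  assumes "is_lead g u"
  shows "is_lead (single n 1 * g) (n + u)"
  unfolding is_lead_def
proof (intro conjI ballI impI)
  show "n + u \<in> keys (single n 1 * g)" using assms by (simp add: is_lead_def in_keys_iff)
  fix m assume m: "m \<in> keys (single n 1 * g)" "m \<noteq> n + u"
  then have "mdvd n m" "m - n \<in> keys g" by (auto simp: in_keys_iff lookup_single_times split: if_splits)
  moreover from this have "n + (m - n) = m" using mdvd_add_iff[of n m "m - n"] by simp
  ultimately show "mono_gt (n + u) m"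
    using assms m(2) mono_gt_add[of u "m - n" n] unfolding is_lead_def by metis
qed

lemma hcomp_ideal_of:
  assumes "f \<in> hspace d1 d2 d3" "g \<in> ideal_of f"
  shows "hcomp n 0 g \<in> ideal_of f"
proof -
  have f': "fst f \<in> Hom d1 0" "fst (snd f) \<in> Hom d2 0" "snd (snd f) \<in> Hom d3 0"
    using assms(1) by (auto simp: hspace_def homogeneous_iff_Hom)
  obtain h1 h2 h3 where g: "g = h1 * fst f + h2 * fst (snd f) + h3 * snd (snd f)"
    using assms(2) unfolding gen_ideal3_def by blast
  show ?thesis
    unfolding g hcomp_add hcomp_mult[OF f'(1)] hcomp_mult[OF f'(2)] hcomp_mult[OF f'(3)] gen_ideal3_def
    by blast
qed

text \<open>A monomial in the initial ideal is divisible by one of the generating leading monomials,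
  and multiplying by the quotient makes it a leading monomial itself. The component of degree
  \<open>mdeg u\<close> keeps \<open>u\<close> and only discards other monomials.\<close>

lemma initial_ideal_homogeneous_lead:
  fixes f :: "'a::comm_ring_1 poly3 \<times> 'a poly3 \<times> 'a poly3"
  assumes f: "f \<in> hspace d1 d2 d3" and u: "Defs.monom u \<in> initial_ideal (ideal_of f)"
  obtains g where "g \<in> ideal_of f" "g \<in> Hom (mdeg u) 0" "is_lead g u"
proof -
  obtain A and H :: "'a poly3 \<Rightarrow> 'a poly3" where A: "A \<subseteq> {Defs.monom (lead_mono g) | g. g \<in> ideal_of f \<and> g \<noteq> 0}"
    and eq: "Defs.monom u = (\<Sum>p\<in>A. H p * p)"
    using u unfolding initial_ideal_def ideal_gen_def by blast
  have "(\<Sum>p\<in>A. lookup (H p * p) u) \<noteq> 0"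
    by (simp add: Defs.monom_def flip: eq lookup_sum)
  then obtain p where p: "p \<in> A" "lookup (H p * p) u \<noteq> 0"
    by (rule sum.not_neutral_contains_not_neutral)
  then obtain g where g: "g \<in> ideal_of f" "g \<noteq> 0" "p = Defs.monom (lead_mono g)" using A by blast
  have "lookup (single (lead_mono g) 1 * H p) u \<noteq> 0"
    using p(2) unfolding g(3) Defs.monom_def by (simp add: mult.commute)
  then have "mdvd (lead_mono g) u" by (simp add: lookup_single_times split: if_splits)
  then have n: "(u - lead_mono g) + lead_mono g = u"
    using mdvd_add_iff[of "lead_mono g" u "u - lead_mono g"] by (simp add: add.commute)
  define h where "h = single (u - lead_mono g) 1 * g"
  have h: "h \<in> ideal_of f" "is_lead h u"
    using gen_ideal3_mult[OF g(1)] is_lead_single_times[OF is_lead_lead_mono[OF g(2)], of "u - lead_mono g"]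
    by (simp_all add: h_def n)
  have "is_lead (hcomp (mdeg u) 0 h) u"
    using h(2) unfolding is_lead_def by (auto simp: in_keys_iff lookup_hcomp split: if_splits)
  then show ?thesis using hcomp_ideal_of[OF f h(1)] hcomp_in_Hom that by blast
qed

section \<open>The initial ideal of a generic ideal\<close>

lemma Hom_divide_X3:
  fixes g :: "'a::comm_ring_1 poly3"
  assumes "g \<in> Hom (i + c) 0" "\<And>x y z. lookup g (x, y, z) \<noteq> 0 \<Longrightarrow> c \<le> z"
  obtains g' where "g' \<in> Hom i 0" "g = X3 ^ c * g'"
proof -
  define g' where "g' = (\<Sum>m\<in>keys g. single (m - (0, 0, c)) (lookup g m))"
  have key: "(0, 0, c) + (m - (0, 0, c)) = m" "mdeg (m - (0, 0, c)) = i" if "m \<in> keys g" for m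
  proof -
    obtain x y z where m: "m = (x, y, z)" by (cases m)
    have "c \<le> z" "x + y + z = i + c"
      using that assms(2)[of x y z] HomD[OF assms(1), of m] by (auto simp: m in_keys_iff mdeg_def)
    then show "(0, 0, c) + (m - (0, 0, c)) = m" "mdeg (m - (0, 0, c)) = i" by (auto simp: m mdeg_def)
  qed
  have "g' \<in> Hom i 0" unfolding g'_def by (intro Hom_sum Hom_single) (simp add: key)
  moreover have "X3 ^ c * g' = (\<Sum>m\<in>keys g. single m (lookup g m))"
    unfolding g'_def X_power sum_distrib_left by (intro sum.cong) (simp_all add: mult_single key)
  then have "g = X3 ^ c * g'" by (simp flip: poly_mapping_sum_single)
  ultimately show ?thesis by (rule that)
qed

lemma submonomial_of_degree:
  assumes "N \<le> mdeg m"
  obtains n k where "n + k = m" "mdeg n = N"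
proof -
  obtain a b c where m: "m = (a, b, c)" by (cases m)
  define a' where "a' = min a N"
  define b' where "b' = min b (N - a')"
  define c' where "c' = N - a' - b'"
  show ?thesis
  proof (rule that)
    show "(a', b', c') + (a - a', b - b', c - c') = m" "mdeg (a', b', c') = N"
      using assms by (auto simp: m mdeg_def a'_def b'_def c'_def)
  qed
qed

lemma almost_revlex_if_bijective:
  fixes f :: "'a::comm_ring_1 poly3 \<times> 'a poly3 \<times> 'a poly3"
  assumes f: "f \<in> hspace d1 d2 d3"
    and bij: "\<And>i k. 2 * i + k = e \<Longrightarrow> multiplication_bijective i 0 k (i + k) f"
    and high: "\<And>s. s \<in> Hom (e + 1) 0 \<Longrightarrow> s \<in> ideal_of f"
    and seg: "\<And>d. d \<le> e \<Longrightarrow> initial_segment d f"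
  shows "almost_revlex (initial_ideal (ideal_of f))"
proof -
  let ?J = "initial_ideal (ideal_of f)"
  have high_monom: "Defs.monom (a, b, c) \<in> ?J" if abc: "e + 1 \<le> 2 * (a + b) + c" for a b c
  proof (cases "e + 1 \<le> a + b + c")
    case True
    then have "e + 1 \<le> mdeg (a, b, c)" by (simp add: mdeg_def)
    then obtain n k where nk: "n + k = (a, b, c)" "mdeg n = e + 1" by (rule submonomial_of_degree)
    have "single n 1 \<in> ideal_of f" by (rule high, rule Hom_single) (simp add: nk)
    then have "single k 1 * single n 1 \<in> ideal_of f" by (rule gen_ideal3_mult)
    then have "single (a, b, c) 1 \<in> ideal_of f" by (simp add: mult_single add.commute flip: nk(1))
    then show ?thesis by (rule monom_in_initial_ideal) (simp add: is_lead_def)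
  next
    case False
    define l where "l = a + b + c"
    \<comment> \<open>Degrees e - l and l are dual, and the assumed inequality says exactly that
      \<open>c < k\<close>. So every monomial of \<open>X3 ^ k * g\<close> has a larger x3-exponent
      than the given monomial and is smaller in the order.\<close>
    define k where "k = 2 * l - e"
    have k: "2 * (e - l) + k = e" "c < k" "e - l + k = l" using False abc by (auto simp: k_def l_def)
    have s: "single (a, b, c) 1 \<in> Hom l (0 :: nat)" by (rule Hom_single) (simp add: mdeg_def l_def)
    then obtain g where g: "g \<in> Hom (e - l) 0" "single (a, b, c) 1 - X3 ^ k * g \<in> ideal_of f"
      using bij[OF k(1), unfolded multiplication_bijective_def[OF refl]] unfolding k(3) by blast
    have Xg: "X3 ^ k * g \<in> Hom l 0" by (rule Hom_multI[OF X_power_Hom(3) g(1)]) (use k in simp)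
    have "is_lead (single (a, b, c) 1 - X3 ^ k * g) (a, b, c)"
      unfolding is_lead_def
    proof (intro conjI ballI impI)
      show "(a, b, c) \<in> keys (single (a, b, c) 1 - X3 ^ k * g)"
        using k(2) by (simp add: in_keys_iff lookup_minus lookup_X_power_times)
      fix m assume m: "m \<in> keys (single (a, b, c) 1 - X3 ^ k * g)" "m \<noteq> (a, b, c)"
      then have nz: "lookup (X3 ^ k * g) m \<noteq> 0" by (auto simp: in_keys_iff lookup_minus lookup_single)
      then have "mdeg m = mdeg (a, b, c)" using HomD[OF Xg, of m] by (simp add: mdeg_def l_def)
      moreover obtain x y z where xyz: "m = (x, y, z)" by (cases m)
      moreover have "k \<le> z" using nz by (auto simp: xyz lookup_X_power_times split: if_splits)
      ultimately show "mono_gt (a, b, c) m" using k(2) by (simp add: mono_gt_def revlex_gt_def)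
    qed
    with g(2) show ?thesis by (rule monom_in_initial_ideal)
  qed
  show ?thesis
    unfolding almost_revlex_def
  proof (intro allI impI, elim conjE)
    fix u v assume min: "min_mono_gen ?J u" and deg: "mdeg v = mdeg u" and gt: "revlex_gt v u"
    obtain a b c where u: "u = (a, b, c)" by (cases u)
    obtain a' b' c' where v: "v = (a', b', c')" by (cases v)
    have c': "c' \<le> c" "a' + b' + c' = a + b + c"
      using deg gt by (auto simp: u v mdeg_def revlex_gt_def)
    have uJ: "Defs.monom u \<in> ?J" using min by (simp add: min_mono_gen_def)
    then obtain g where g: "g \<in> ideal_of f" "g \<in> Hom (mdeg u) 0" "is_lead g u"
      by (rule initial_ideal_homogeneous_lead[OF f])
    show "Defs.monom v \<in> ?J"
    proof (cases "e + 1 \<le> 2 * (a + b) + c")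
      case True
      \<comment> \<open>The expression is twice the degree minus the x3-exponent, and that exponent
        does not grow on passing to a larger monomial of the same degree.\<close>
      then have "e + 1 \<le> 2 * (a' + b') + c'" using c' by simp
      then show ?thesis unfolding v by (rule high_monom)
    next
      case False
      define i where "i = a + b"
      have deg_u: "mdeg u = i + c" by (simp add: u mdeg_def i_def)
      \<comment> \<open>For c > 0 all monomials of \<open>g\<close> are divisible by x3^c, because
        the leading one is and, within a degree, the order looks at x3 first. After division
        injectivity puts \<open>g'\<close> into the ideal, so \<open>u\<close> divided by x3 is
        already a leading monomial, against minimality.\<close>
      have "c = 0"
      proof (rule ccontr)
        assume "c \<noteq> 0"
        then obtain p where p: "c = Suc p" by (cases c) auto
        have "c \<le> z" if "lookup g (x, y, z) \<noteq> 0" for x y z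
        proof (cases "(x, y, z) = u")
          case False
          then have "mono_gt u (x, y, z)" using g(3) that by (simp add: is_lead_def in_keys_iff)
          moreover have "mdeg (x, y, z) = mdeg u" using HomD[OF g(2) that] by simp
          ultimately show ?thesis by (auto simp: mono_gt_def revlex_gt_def u)
        qed (simp add: u)
        then obtain g' where g': "g' \<in> Hom i 0" "g = X3 ^ c * g'"
          using Hom_divide_X3[OF g(2)[unfolded deg_u]] by blast
        define k where "k = e - 2 * i"
        have k: "2 * i + k = e" "k = (k - c) + c" using False by (auto simp: k_def i_def)
        have "X3 ^ (k - c) * g \<in> ideal_of f" using g(1) by (rule gen_ideal3_mult)
        also have "X3 ^ (k - c) * g = X3 ^ k * g'" by (subst (2) k(2)) (simp add: g'(2) power_add mult.assoc)
        finally have "g' \<in> ideal_of f"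
          using bij[OF k(1), unfolded multiplication_bijective_def[OF refl]] g'(1) by blast
        then have "X3 ^ p * g' \<in> ideal_of f" by (rule gen_ideal3_mult)
        moreover have "is_lead (X3 ^ p * g') (a, b, p)"
        proof -
          have shift: "lookup (X3 ^ p * g') (x, y, z) = lookup g (x, y, Suc z)" for x y z
            using lookup_X_power_times(3)[of 1 "X3 ^ p * g'" x y "Suc z"] by (simp add: g'(2) p mult.assoc)
          show ?thesis
            unfolding is_lead_def
          proof (intro conjI ballI impI)
            show "(a, b, p) \<in> keys (X3 ^ p * g')"
              using g(3) by (simp add: is_lead_def in_keys_iff shift u p)
            fix m assume m: "m \<in> keys (X3 ^ p * g')" "m \<noteq> (a, b, p)"
            obtain x y z where xyz: "m = (x, y, z)" by (cases m)
            have "(x, y, Suc z) \<in> keys g" "(x, y, Suc z) \<noteq> u"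
              using m by (auto simp: xyz in_keys_iff shift u p)
            then have "mono_gt u (x, y, Suc z)" using g(3) by (simp add: is_lead_def)
            then show "mono_gt (a, b, p) m" by (simp add: xyz u p mono_gt_def revlex_gt_def mdeg_def)
          qed
        qed
        ultimately have "Defs.monom (a, b, p) \<in> ?J" by (rule monom_in_initial_ideal)
        moreover have "(a, b, p) \<noteq> u" "mdvd (a, b, p) u" by (simp_all add: u p mdvd_def)
        ultimately show False using min unfolding min_mono_gen_def by blast
      qed
      then have c0: "c = 0" "c' = 0" "b' < b" "a' + b' = i"
        using c' gt by (auto simp: u v revlex_gt_def i_def)
      have gi: "g \<in> Hom i 0" using g(2) by (simp add: deg_u c0(1))
      have "i \<le> e" using False by (simp add: i_def)
      then have "initial_segment i f" by (rule seg)
      then obtain r where r: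
        "\<forall>b<r. \<exists>g\<in>ideal_of f \<inter> Hom i 0. \<forall>b'<r. restriction_coeff i g b' = (if b' = b then 1 else 0)"
        "\<forall>g\<in>ideal_of f \<inter> Hom i 0. (\<forall>b<r. restriction_coeff i g b = 0) \<longrightarrow> (\<forall>b. restriction_coeff i g b = 0)"
        unfolding initial_segment_def by (elim exE conjE)
      have "restriction_coeff i g b \<noteq> 0"
        using g(3) by (simp add: restriction_coeff_def is_lead_def in_keys_iff u c0(1) i_def)
      \<comment> \<open>The leading exponent \<open>b\<close> is the least index with a nonzero
        restriction coefficient. Some nonzero one occurs below \<open>r\<close>, hence
        \<open>b\<close> and the smaller \<open>b'\<close> are below \<open>r\<close> too.\<close>
      then obtain b1 where b1: "b1 < r" "restriction_coeff i g b1 \<noteq> 0"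
        using bspec[OF r(2), of g] g(1) gi by blast
      have "b \<le> b1"
      proof (rule ccontr)
        assume "\<not> b \<le> b1"
        moreover have "b1 \<le> i" "(i - b1, b1, 0) \<in> keys g"
          using b1(2) by (auto simp: restriction_coeff_def in_keys_iff split: if_splits)
        ultimately show False
          using g(3) by (auto simp: is_lead_def u c0(1) mono_gt_def revlex_gt_def mdeg_def i_def)
      qed
      then have b'r: "b' < r" using c0(3) b1(1) by simp
      then obtain h where h: "h \<in> ideal_of f" "h \<in> Hom i 0"
        "\<And>b1. b1 < r \<Longrightarrow> restriction_coeff i h b1 = (if b1 = b' then 1 else 0)"
        using r(1)[rule_format, OF b'r] by blast
      have rc: "restriction_coeff i h y = lookup h (x, y, 0)" if "x + y = i" for x y
        using that by (auto simp: restriction_coeff_def)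
      have "is_lead h v"
        unfolding is_lead_def
      proof (intro conjI ballI impI)
        show "v \<in> keys h" using h(3)[OF b'r] rc[OF c0(4)] by (simp add: v c0(2) in_keys_iff)
        fix m assume m: "m \<in> keys h" "m \<noteq> v"
        obtain x y z where xyz: "m = (x, y, z)" by (cases m)
        have deg_m: "x + y + z = i" using HomD[OF h(2), of m] m(1) by (simp add: in_keys_iff xyz mdeg_def)
        \<comment> \<open>Below index \<open>r\<close> the only nonzero restriction coefficient of
          \<open>h\<close> is the one at \<open>b'\<close>, so any other monomial free of x3 has
          x2-exponent at least \<open>r\<close>; monomials containing x3 are smaller anyway.\<close>
        have "b' < y" if "z = 0"
        proof -
          have y: "restriction_coeff i h y \<noteq> 0" using rc[of x y] m(1) deg_m that by (simp add: in_keys_iff xyz)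
          have "y \<noteq> b'" using m(2) deg_m that c0 by (auto simp: xyz v)
          then have "\<not> y < r" using h(3)[of y] y by auto
          then show ?thesis using b'r by simp
        qed
        then show "mono_gt v m"
          using deg_m c0 by (auto simp: mono_gt_def revlex_gt_def mdeg_def xyz v)
      qed
      with h(1) show ?thesis by (rule monom_in_initial_ideal)
    qed
  qed
qed

theorem theorem1p2:
  fixes d1 d2 d3 :: nat
  assumes "0 < d1" and "0 < d2" and "0 < d3"
  shows "generic d1 d2 d3
           (\<lambda>(f1, f2, f3). almost_revlex
              (initial_ideal (gen_ideal3 (f1 :: 'a::field_char_0 poly3) f2 f3)))"
proof -
  define e where "e = d1 + d2 + d3 - 3"
  have e: "d1 + d2 + d3 = e + 3" using assms by (simp add: e_def)
  define f0 :: "'a poly3 \<times> 'a poly3 \<times> 'a poly3" where "f0 = (X1 ^ d1, X2 ^ d2, (X3 - X1 - X2) ^ d3)"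
  have f0: "f0 \<in> hspace d1 d2 d3" unfolding f0_def by (rule special_in_hspace[OF e])
  have koszul: "\<exists>u v w. h1 = u * fst (snd f0) + v * snd (snd f0) \<and> h2 = - u * fst f0 + w * snd (snd f0) \<and>
      h3 = - v * fst f0 - w * fst (snd f0)"
    if "h1 * fst f0 + h2 * fst (snd f0) + h3 * snd (snd f0) = 0" for h1 h2 h3
    using that unfolding f0_def fst_conv snd_conv by (rule special_koszul[OF e]) blast
  have bij: "principal_generic d1 d2 d3 (multiplication_bijective i 0 k (i + k) :: 'a poly3 \<times> 'a poly3 \<times> 'a poly3 \<Rightarrow> bool)"
    if ik: "2 * i + k = e" for i k
  proof (rule generic_multiplication_bijective[OF refl f0 _ _ koszul])
    show "\<exists>g\<in>Hom i 0. s - X3 ^ k * g \<in> ideal_of f0" if "s \<in> Hom (i + k) 0" for s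
      by (rule special_surjective[OF e ik that]) (auto simp: f0_def)
    show "g \<in> ideal_of f0" if "g \<in> Hom i 0" "X3 ^ k * g \<in> ideal_of f0" for g
      using special_injective[OF e ik that(1)] that(2) by (simp add: f0_def)
  qed
  have Hom01: "Hom 0 1 = ({0} :: 'a poly3 set)"
  proof (intro set_eqI iffI)
    fix h :: "'a poly3" assume "h \<in> Hom 0 1"
    then have "lookup h m = 0" for m using HomD[of h 0 1 m] by auto
    then show "h \<in> {0}" by (simp add: poly_mapping_eqI)
  qed simp
  \<comment> \<open>Degree e + 1 is reached as e + 2 - \<delta> with \<delta> = 1, where the source
    is the zero space of degree -1, so the same openness theorem covers the vanishing of the
    quotient above the socle.\<close>
  have high: "principal_generic d1 d2 d3
      (multiplication_bijective 0 1 (e + 2) (0 + (e + 2)) :: 'a poly3 \<times> 'a poly3 \<times> 'a poly3 \<Rightarrow> bool)"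
  proof (rule generic_multiplication_bijective[OF refl f0 _ _ koszul])
    show "\<exists>g\<in>Hom 0 1. s - X3 ^ (e + 2) * g \<in> ideal_of f0" if "s \<in> Hom (0 + (e + 2)) 1" for s
      by (rule bexI[of _ 0]) (use special_high_degree[OF e _ Hom_regrade[OF that, of "e + 1" 0]] in \<open>simp_all add: f0_def\<close>)
    show "g \<in> ideal_of f0" if "g \<in> Hom 0 1" for g
      using that unfolding Hom01 by (simp add: gen_ideal3_zero)
  qed
  have "principal_generic d1 d2 d3 (\<lambda>f :: 'a poly3 \<times> 'a poly3 \<times> 'a poly3.
      (\<forall>i\<in>{i. 2 * i \<le> e}. multiplication_bijective i 0 (e - 2 * i) (i + (e - 2 * i)) f) \<and>
      multiplication_bijective 0 1 (e + 2) (0 + (e + 2)) f \<and> (\<forall>d\<in>{..e}. initial_segment d f))"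
    by (intro principal_generic_conj principal_generic_ball bij high generic_initial_segment)
      (auto intro: finite_subset[of _ "{..e}"])
  then have "principal_generic d1 d2 d3 (\<lambda>f :: 'a poly3 \<times> 'a poly3 \<times> 'a poly3.
      almost_revlex (initial_ideal (ideal_of f)))"
  proof (rule principal_generic_mono, elim conjE)
    fix f :: "'a poly3 \<times> 'a poly3 \<times> 'a poly3"
    assume f: "f \<in> hspace d1 d2 d3"
      and bij: "\<forall>i\<in>{i. 2 * i \<le> e}. multiplication_bijective i 0 (e - 2 * i) (i + (e - 2 * i)) f"
      and high: "multiplication_bijective 0 1 (e + 2) (0 + (e + 2)) f"
      and seg: "\<forall>d\<in>{..e}. initial_segment d f"
    show "almost_revlex (initial_ideal (ideal_of f))"
    proof (rule almost_revlex_if_bijective[OF f])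
      show "multiplication_bijective i 0 k (i + k) f" if ik: "2 * i + k = e" for i k
      proof -
        have "k = e - 2 * i" "2 * i \<le> e" using ik by auto
        then show ?thesis using bij by simp
      qed
      show "s \<in> ideal_of f" if "s \<in> Hom (e + 1) 0" for s
        using high Hom_regrade[OF that, of "0 + (e + 2)" 1]
        unfolding multiplication_bijective_def[OF refl] Hom01 by simp
      show "initial_segment d f" if "d \<le> e" for d using seg that by simp
    qed
  qed
  then show ?thesis
    by (intro generic_if_principal_generic) (simp add: case_prod_unfold)
qed

end
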